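(* Let $n\ge 1$ and let $a=(a_1,\dots,a_n)$ be a weak composition (a sequence of $n$ nonnegative integers). Let $Q_b^a(\beta), M_b^a(\beta)\in\mathbb{Z}[\beta]$ be the coefficients in the expansions $$\overline{\mathfrak{A}}_a=\sum_b Q_b^a(\beta)\,\overline{\mathfrak{P}}_b,\qquad \overline{\mathfrak{Q}}_a=\sum_b M_b^a(\beta)\,\overline{\mathfrak{F}}_b$$ of the Lascoux atom $\overline{\mathfrak{A}}_a$ into kaons $\overline{\mathfrak{P}}_b$ and of the quasiLascoux polynomial $\overline{\mathfrak{Q}}_a$ into glide polynomials $\overline{\mathfrak{F}}_b$, where $b$ ranges over all weak compositions of length $n$. If the nonzero parts of $a$ are weakly decreasing (i.e. the sequence obtained from $a$ by deleting zeros is weakly decreasing from left to right), then $$\sum_b Q_b^a(-1)=\sum_b M_b^a(-1)=1,$$ and otherwise $$\sum_b Q_b^a(-1)=\sum_b M_b^a(-1)=0,$$ where the sums are taken over all weak compositions $b$.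
   Context: Fix $n\ge1$. A weak composition is a sequence $a=(a_1,\dots,a_n)$ of nonnegative integers; $|a|=a_1+\dots+a_n$; $a^+$ denotes the sequence of nonzero entries of $a$ in order; $\mathbf{x}^a=x_1^{a_1}\cdots x_n^{a_n}$. Write $b\ge a$ ($b$ dominates $a$) if $b_1+\dots+b_i\ge a_1+\dots+a_i$ for every $i$. Each of the four families below, indexed by all weak compositions of length $n$, is a basis of $\mathbb{Z}[x_1,\dots,x_n][\beta]$ over $\mathbb{Z}[\beta]$, so the coefficients $Q_b^a(\beta)$ and $M_b^a(\beta)$ are well defined (and only finitely many are nonzero for given $a$). **Kaons.** A weak komposition $b=(b_1,\dots,b_n)$ is a weak composition whose nonzero entries are each colored red or black; its excess $\mathrm{ex}(b)$ is the number of red entries, and the same notation is used for consecutive subsequences of $b$. Let $a$ have nonzero entries exactly at positions $n_1<n_2<\dots<n_\ell$, and set $n_0=0$. A weak komposition $b$ is a mesonic glide of $a$ if $b_i=0$ for all $i>n_\ell$ and, for every $1\le j\le\ell$: (1) $a_{n_j}=b_{n_{j-1}+1}+\dots+b_{n_j}-\mathrm{ex}(b_{n_{j-1}+1},\dots,b_{n_j})$; (2) the leftmost nonzero entry of $(b_{n_{j-1}+1},\dots,b_{n_j})$ is black; (3) $b_{n_j}\ne0$. (If $a=(0,\dots,0)$, take $\ell=0$, so the only mesonic glide is $(0,\dots,0)$.) The kaon is $\overline{\mathfrak{P}}_a=\sum_{b}\beta^{\mathrm{ex}(b)}\mathbf{x}^b$, the sum over all mesonic glides $b$ of $a$. **Lascoux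 atoms.** The skyline diagram of shape $a$ consists of $n$ left-justified rows of boxes, the $i$th row from the bottom (row $i$) having $a_i$ boxes. A set-valued skyline filling $T$ of shape $a$ fills each box with a nonempty finite set of positive integers. The largest entry of a box is its anchor; the other entries are free. $T$ is semistandard if: (S.1) There are no repeated entries in any column. (S.2) Entries weakly decrease along rows: the smallest entry of each box is at least the largest entry of the box immediately to its right. (S.3) Whenever anchors $\alpha,\beta,\gamma$ are such that (i) the box of $\alpha$ is immediately to the right of the box of $\beta$ in the same row, (ii) the row containing $\alpha$ and $\beta$ is at least as long as the row containing $\gamma$ if it is lower than the row of $\gamma$, and strictly longer if it is higher than the row of $\gamma$, and (iii) $\gamma$ is either above $\alpha$ in the same column as $\alpha$, or below $\beta$ in the same column as $\beta$, then $\gamma<\alpha$ or $\gamma>\beta$. (S.4) Each free entry lies in the box of its column with the smallest possible anchor such that (S.2) is satisfied. (S.5) Each anchor in the leftmost column equals the index of its row. Let $\overline{\mathfrak{A}}\mathsf{SSF}(a)$ be the set of semistandard set-valued skyline fillings of shape $a$. Let $\mathrm{wt}(T)$ be the weak composition whose $i$th part is the number of times $i$ appears as an entry in $T$, let $|T|$ be the total number of entries of $T$, and let $\mathrm{ex}(T)=|T|-|a|$ (the number of free entries). The Lascoux atom is $\overline{\mathfrak{A}}_a=\sum_{T\in\overline{\mathfrak{A}}\mathsf{SSF}(a)}\beta^{\mathrm{ex}(T)}\mathbf{x}^{\mathrm{wt}(T)}$. **Glide and quasiLascoux polynomials.** The glide polynomial is $\overline{\mathfrak{F}}_a=\sum_{b\ge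 a,\ b^+=a^+}\overline{\mathfrak{P}}_b$, and the quasiLascoux polynomial is $\overline{\mathfrak{Q}}_a=\sum_{b\ge a,\ b^+=a^+}\overline{\mathfrak{A}}_b$, the sums being over weak compositions $b$ of length $n$. *)

theory Defs
  imports "HOL-Library.Poly_Mapping" "HOL-Computational_Algebra.Polynomial"
begin

section \<open>Weak compositions and polynomials\<close>

text \<open>
  A sequence \<open>a = (a\<^sub>1, \<dots>, a\<^sub>n)\<close> of nonnegative integers is a finitely supported function
  \<open>nat \<Rightarrow>\<^sub>0 nat\<close> vanishing outside \<open>{1..n}\<close>, with \<open>a\<^sub>i = entry a i\<close>. It also serves as the exponent
  of the monomial \<open>x\<^sub>1^a\<^sub>1 \<cdots> x\<^sub>n^a\<^sub>n\<close>.
\<close>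

type_synonym wcomp = "nat \<Rightarrow>\<^sub>0 nat"

abbreviation entry :: "('a \<Rightarrow>\<^sub>0 'b::zero) \<Rightarrow> 'a \<Rightarrow> 'b" where
  "entry \<equiv> Poly_Mapping.lookup"

definition weak_compositions :: "nat \<Rightarrow> wcomp set" where
  "weak_compositions n = {a. Poly_Mapping.keys a \<subseteq> {1..n}}"

definition wsize :: "wcomp \<Rightarrow> nat" where
  "wsize a = (\<Sum>i\<in>Poly_Mapping.keys a. entry a i)"

text \<open>The sequence \<open>a\<^sup>+\<close> of nonzero entries, from left to right.\<close>

definition flat :: "wcomp \<Rightarrow> nat list" where
  "flat a = map (entry a) (sorted_list_of_set (Poly_Mapping.keys a))"

definition dominates :: "nat \<Rightarrow> wcomp \<Rightarrow> wcomp \<Rightarrow> bool" where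
  "dominates n b a \<longleftrightarrow> (\<forall>i\<in>{1..n}. (\<Sum>k=1..i. entry a k) \<le> (\<Sum>k=1..i. entry b k))"

text \<open>
  Polynomials in \<open>x\<^sub>1, x\<^sub>2, \<dots>\<close> over \<open>\<int>[\<beta>]\<close>, where \<open>\<int>[\<beta>]\<close> is \<^typ>\<open>int poly\<close>.
\<close>

type_synonym xpoly = "wcomp \<Rightarrow>\<^sub>0 int poly"

text \<open>\<open>beta_monomial k a\<close> is \<open>\<beta>^k x^a\<close>.\<close>

definition beta_monomial :: "nat \<Rightarrow> wcomp \<Rightarrow> xpoly" where
  "beta_monomial k a = Poly_Mapping.single a (monom 1 k)"

definition const_xpoly :: "int poly \<Rightarrow> xpoly" where
  "const_xpoly c = Poly_Mapping.single 0 c"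


section \<open>Kaons\<close>

text \<open>
  A weak komposition is a pair of a weak composition and the set of positions of its red entries;
  the other nonzero entries are black.
\<close>

type_synonym wkomp = "wcomp \<times> nat set"

definition weak_kompositions :: "nat \<Rightarrow> wkomp set" where
  "weak_kompositions n = {(b, R). b \<in> weak_compositions n \<and> R \<subseteq> Poly_Mapping.keys b}"

text \<open>For \<open>p = n\<^sub>j\<close>, the block of \<open>p\<close> is the interval \<open>{n\<^bsub>j-1\<^esub>+1..n\<^sub>j}\<close>.\<close>

definition block :: "wcomp \<Rightarrow> nat \<Rightarrow> nat set" where
  "block a p = {i. 1 \<le> i \<and> i \<le> p \<and> (\<forall>q. i \<le> q \<and> q < p \<longrightarrow> entry a q = 0)}"

text \<open>
  In the first condition the excess is moved to the left-hand side to avoid a subtraction. The last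
  condition says that \<open>b\<^sub>i = 0\<close> for \<open>i > n\<^sub>\<ell>\<close> (and for all \<open>i\<close> if \<open>\<ell> = 0\<close>).
\<close>

definition mesonic_glide :: "nat \<Rightarrow> wcomp \<Rightarrow> wkomp \<Rightarrow> bool" where
  "mesonic_glide n a = (\<lambda>(b, R).
     (b, R) \<in> weak_kompositions n \<and>
     (\<forall>p\<in>Poly_Mapping.keys a.
        entry a p + card (R \<inter> block a p) = (\<Sum>i\<in>block a p. entry b i) \<and>
        (\<forall>i\<in>block a p.
           entry b i \<noteq> 0 \<and> (\<forall>k\<in>block a p. k < i \<longrightarrow> entry b k = 0) \<longrightarrow> i \<notin> R) \<and>
        entry b p \<noteq> 0) \<and>
     (\<forall>i. (\<forall>p\<in>Poly_Mapping.keys a. p < i) \<longrightarrow> entry b i = 0))"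

definition kaon :: "nat \<Rightarrow> wcomp \<Rightarrow> xpoly" where
  "kaon n a = (\<Sum>(b, R) | mesonic_glide n a (b, R). beta_monomial (card R) b)"


section \<open>Lascoux atoms\<close>

text \<open>
  A box is addressed by its row, counted from the bottom, and its column, counted from the left.
  Fillings are empty outside the diagram, so that distinct functions are distinct fillings.
\<close>

definition diagram :: "wcomp \<Rightarrow> (nat \<times> nat) set" where
  "diagram a = (SIGMA r:Poly_Mapping.keys a. {1..entry a r})"

type_synonym filling = "nat \<Rightarrow> nat \<Rightarrow> nat set"

definition set_valued_filling :: "wcomp \<Rightarrow> filling \<Rightarrow> bool" where
  "set_valued_filling a T \<longleftrightarrow>
     (\<forall>r c. if (r, c) \<in> diagram a then T r c \<noteq> {} \<and> finite (T r c) \<and> 0 \<notin> T r c else T r c = {})"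

abbreviation anchor :: "filling \<Rightarrow> nat \<Rightarrow> nat \<Rightarrow> nat" where
  "anchor T r c \<equiv> Max (T r c)"

definition columns_distinct :: "wcomp \<Rightarrow> filling \<Rightarrow> bool" where
  "columns_distinct a T \<longleftrightarrow>
     (\<forall>r r' c. (r, c) \<in> diagram a \<and> (r', c) \<in> diagram a \<and> r \<noteq> r' \<longrightarrow> T r c \<inter> T r' c = {})"

definition rows_decreasing :: "wcomp \<Rightarrow> filling \<Rightarrow> bool" where
  "rows_decreasing a T \<longleftrightarrow>
     (\<forall>r c. (r, c) \<in> diagram a \<and> (r, Suc c) \<in> diagram a \<longrightarrow> Max (T r (Suc c)) \<le> Min (T r c))"

text \<open>
  Here \<open>\<alpha>\<close>, \<open>\<beta>\<close>, \<open>\<gamma>\<close> are the anchors of the boxes \<open>(r, Suc c)\<close>, \<open>(r, c)\<close>, \<open>(r', c')\<close>.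
\<close>

definition triple_condition :: "wcomp \<Rightarrow> filling \<Rightarrow> bool" where
  "triple_condition a T \<longleftrightarrow>
     (\<forall>r c r' c'. (r, c) \<in> diagram a \<and> (r, Suc c) \<in> diagram a \<and> (r', c') \<in> diagram a \<and>
        (r < r' \<longrightarrow> entry a r \<ge> entry a r') \<and> (r > r' \<longrightarrow> entry a r > entry a r') \<and>
        (r' > r \<and> c' = Suc c \<or> r' < r \<and> c' = c) \<longrightarrow>
        anchor T r' c' < anchor T r (Suc c) \<or> anchor T r' c' > anchor T r c)"

text \<open>
  A free entry \<open>e\<close> of column \<open>c\<close> could be placed in the box \<open>(r, c)\<close> as a free entry, keeping the
  rows weakly decreasing, iff it is smaller than the anchor of this box and at least as large as
  the anchor of the box immediately to the right, if there is one.
\<close>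

definition free_entry_fits :: "wcomp \<Rightarrow> filling \<Rightarrow> nat \<Rightarrow> nat \<Rightarrow> nat \<Rightarrow> bool" where
  "free_entry_fits a T e r c \<longleftrightarrow>
     (r, c) \<in> diagram a \<and> e < anchor T r c \<and>
     ((r, Suc c) \<in> diagram a \<longrightarrow> anchor T r (Suc c) \<le> e)"

definition free_entries_minimal :: "wcomp \<Rightarrow> filling \<Rightarrow> bool" where
  "free_entries_minimal a T \<longleftrightarrow>
     (\<forall>(r, c)\<in>diagram a. \<forall>e\<in>T r c. e \<noteq> anchor T r c \<longrightarrow>
        (\<forall>r'. free_entry_fits a T e r' c \<longrightarrow> anchor T r c \<le> anchor T r' c))"

definition semistandard :: "wcomp \<Rightarrow> filling \<Rightarrow> bool" where
  "semistandard a T \<longleftrightarrow>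
     columns_distinct a T \<and> rows_decreasing a T \<and> triple_condition a T \<and>
     free_entries_minimal a T \<and> (\<forall>r. (r, 1) \<in> diagram a \<longrightarrow> anchor T r 1 = r)"

definition SSF :: "wcomp \<Rightarrow> filling set" where
  "SSF a = {T. set_valued_filling a T \<and> semistandard a T}"

definition filling_weight :: "wcomp \<Rightarrow> filling \<Rightarrow> wcomp" where
  "filling_weight a T = (\<Sum>(r, c)\<in>diagram a. \<Sum>e\<in>T r c. Poly_Mapping.single e 1)"

definition filling_excess :: "wcomp \<Rightarrow> filling \<Rightarrow> nat" where
  "filling_excess a T = (\<Sum>(r, c)\<in>diagram a. card (T r c)) - wsize a"

definition lascoux_atom :: "wcomp \<Rightarrow> xpoly" where
  "lascoux_atom a = (\<Sum>T\<in>SSF a. beta_monomial (filling_excess a T) (filling_weight a T))"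


section \<open>Glide and quasiLascoux polynomials\<close>

definition glide_poly :: "nat \<Rightarrow> wcomp \<Rightarrow> xpoly" where
  "glide_poly n a = (\<Sum>b | b \<in> weak_compositions n \<and> dominates n b a \<and> flat b = flat a. kaon n b)"

definition quasi_lascoux :: "nat \<Rightarrow> wcomp \<Rightarrow> xpoly" where
  "quasi_lascoux n a =
     (\<Sum>b | b \<in> weak_compositions n \<and> dominates n b a \<and> flat b = flat a. lascoux_atom b)"


section \<open>Expansion coefficients\<close>

text \<open>
  The coefficients of \<open>f\<close> in the family \<open>F\<close> indexed by the weak compositions of length \<open>n\<close>;
  meaningful if this family is a basis of \<open>\<int>[x\<^sub>1, \<dots>, x\<^sub>n][\<beta>]\<close> over \<open>\<int>[\<beta>]\<close> and \<open>f\<close> belongs to this ring.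
\<close>

definition expansion :: "nat \<Rightarrow> (wcomp \<Rightarrow> xpoly) \<Rightarrow> xpoly \<Rightarrow> (wcomp \<Rightarrow>\<^sub>0 int poly)" where
  "expansion n F f = (THE C. Poly_Mapping.keys C \<subseteq> weak_compositions n \<and>
     f = (\<Sum>b\<in>Poly_Mapping.keys C. const_xpoly (entry C b) * F b))"

definition Q_coeffs :: "nat \<Rightarrow> wcomp \<Rightarrow> (wcomp \<Rightarrow>\<^sub>0 int poly)" where
  "Q_coeffs n a = expansion n (kaon n) (lascoux_atom a)"

definition M_coeffs :: "nat \<Rightarrow> wcomp \<Rightarrow> (wcomp \<Rightarrow>\<^sub>0 int poly)" where
  "M_coeffs n a = expansion n (glide_poly n) (quasi_lascoux n a)"

text \<open>
  The sum of \<open>C\<^sub>b(z)\<close> over all weak compositions \<open>b\<close>; only the finitely many \<open>b\<close> with \<open>C\<^sub>b \<noteq> 0\<close>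
  contribute.
\<close>

definition coeff_sum_at :: "int \<Rightarrow> (wcomp \<Rightarrow>\<^sub>0 int poly) \<Rightarrow> int" where
  "coeff_sum_at z C = (\<Sum>b\<in>Poly_Mapping.keys C. poly (entry C b) z)"

end

theory Submission
  imports Defs "HOL-Library.Product_Lexorder"
begin

text \<open>
  Put \<open>\<beta> = -1\<close>. For \<open>K = supp a \<subseteq> T \<subseteq> {1..max K}\<close>, setting \<open>x\<^sub>i = 1\<close> for \<open>i \<in> T\<close> and \<open>x\<^sub>i = 0\<close> otherwise turns
  kaons and Lascoux atoms into signed counts of glides and fillings with support in \<open>T\<close>. Sign-reversing
  involutions show that the kaon of \<open>a\<close> evaluates to \<open>1\<close> if \<open>T = K\<close> and to \<open>0\<close> otherwise, and that the same
  is true of the Lascoux atom if the nonzero parts of \<open>a\<close> are weakly decreasing, whereas it always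
  evaluates to \<open>0\<close> if they are not.

  Summing over all \<open>T\<close> gives a linear functional, \<open>x\<^sup>b \<mapsto> #{T. supp b \<subseteq> T \<subseteq> {1..max (supp b)}}\<close>, which takes
  the value \<open>1\<close> on every kaon, so that the sum of the \<open>Q\<close> coefficients is its value on the Lascoux atom.
  For the \<open>M\<close> coefficients one uses the evaluation at \<open>x = (1, \<dots>, 1)\<close> instead: among the \<open>b \<ge> a\<close> with
  \<open>b\<^sup>+ = a\<^sup>+\<close> exactly one has no zero to the left of a nonzero entry, so it takes the value \<open>1\<close> on every
  glide polynomial.
\<close>

section \<open>Linear functionals at \<open>\<beta> = -1\<close> and unitriangular families\<close>

text \<open>The linear extension of \<open>g\<close> from monomials to polynomials, after \<beta> is
  set to -1. For \<open>g\<close> constantly 1 this is evaluation with every variable equal to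
  1.\<close>

definition beta_eval :: "(wcomp \<Rightarrow> int) \<Rightarrow> xpoly \<Rightarrow> int" where
  "beta_eval g f = (\<Sum>b\<in>Poly_Mapping.keys f. poly (entry f b) (-1) * g b)"

lemma beta_eval_superset:
  assumes "finite K" "Poly_Mapping.keys f \<subseteq> K"
  shows "beta_eval g f = (\<Sum>b\<in>K. poly (entry f b) (-1) * g b)"
  unfolding beta_eval_def using assms by (intro sum.mono_neutral_left) (auto simp: in_keys_iff)

lemma beta_eval_add: "beta_eval g (f + h) = beta_eval g f + beta_eval g h"
proof -
  let ?K = "Poly_Mapping.keys f \<union> Poly_Mapping.keys h"
  have "Poly_Mapping.keys (f + h) \<subseteq> ?K"
    by (rule Poly_Mapping.keys_add)
  then show ?thesis
    by (simp add: beta_eval_superset[where K = ?K] lookup_add sum.distrib[symmetric] algebra_simps)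
qed

lemma beta_eval_zero [simp]: "beta_eval g 0 = 0"
  by (simp add: beta_eval_def)

lemma beta_eval_sum: "beta_eval g (\<Sum>i\<in>I. f i) = (\<Sum>i\<in>I. beta_eval g (f i))"
  by (induction I rule: infinite_finite_induct) (simp_all add: beta_eval_add)

lemma beta_eval_beta_monomial: "beta_eval g (beta_monomial k b) = (-1) ^ k * g b"
  by (simp add: beta_eval_def beta_monomial_def poly_monom)

lemma lookup_const_xpoly_times [simp]: "entry (const_xpoly c * f) b = c * entry f b"
  unfolding const_xpoly_def mult_map_scale_conv_mult[symmetric]
  by (simp add: Poly_Mapping.map.rep_eq when_def)

lemma beta_eval_const_xpoly_times: "beta_eval g (const_xpoly c * f) = poly c (-1) * beta_eval g f"
proof -
  have "Poly_Mapping.keys (const_xpoly c * f) \<subseteq> Poly_Mapping.keys f"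
    by (auto simp: in_keys_iff lookup_const_xpoly_times)
  then show ?thesis
    by (simp add: beta_eval_superset[where K = "Poly_Mapping.keys f"] sum_distrib_left mult.assoc)
qed

text \<open>Apply the functional to both sides: each \<open>F b\<close> contributes 1, which leaves
  the sum of the values \<open>poly (entry C b) (-1)\<close>.\<close>

lemma coeff_sum_at_expansion:
  assumes "f = (\<Sum>b\<in>Poly_Mapping.keys C. const_xpoly (entry C b) * F b)"
    and "\<And>b. b \<in> Poly_Mapping.keys C \<Longrightarrow> beta_eval g (F b) = 1"
  shows "coeff_sum_at (-1) C = beta_eval g f"
  by (simp add: assms beta_eval_sum beta_eval_const_xpoly_times coeff_sum_at_def)

section \<open>Unitriangular families: existence and uniqueness of expansions\<close>

text \<open>
  Lexicographic. Passing from \<open>x\<^sup>a\<close> to another monomial of the kaon of \<open>a\<close> enlarges the support, and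
  passing from \<open>a\<close> to another index of the sum defining its glide polynomial moves weight to the left.
\<close>

definition weight_order :: "nat \<Rightarrow> wcomp \<Rightarrow> nat \<times> nat" where
  "weight_order n b = (n - card (Poly_Mapping.keys b), \<Sum>k\<in>{1..n}. k * entry b k)"

definition unitriangular :: "nat \<Rightarrow> (wcomp \<Rightarrow> xpoly) \<Rightarrow> bool" where
  "unitriangular n F \<longleftrightarrow> (\<forall>a\<in>weak_compositions n. entry (F a) a = 1 \<and>
     (\<forall>b. b \<noteq> a \<longrightarrow> entry (F a) b \<noteq> 0 \<longrightarrow> b \<in> weak_compositions n \<and> weight_order n b < weight_order n a))"

definition expands :: "nat \<Rightarrow> (wcomp \<Rightarrow> xpoly) \<Rightarrow> xpoly \<Rightarrow> (wcomp \<Rightarrow>\<^sub>0 int poly) \<Rightarrow> bool" where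
  "expands n F f C \<longleftrightarrow> Poly_Mapping.keys C \<subseteq> weak_compositions n \<and>
     f = (\<Sum>b\<in>Poly_Mapping.keys C. const_xpoly (entry C b) * F b)"

lemma const_xpoly_simps:
  "const_xpoly 0 = 0" "const_xpoly (c + d) = const_xpoly c + const_xpoly d"
  "const_xpoly (c * d) = const_xpoly c * const_xpoly d"
  by (simp_all add: const_xpoly_def single_add mult_single)

text \<open>Padding with zero coefficients lets two expansions be written over a common index set
  and added termwise.\<close>

lemma expands_superset:
  assumes "expands n F f C" "finite K" "Poly_Mapping.keys C \<subseteq> K"
  shows "f = (\<Sum>b\<in>K. const_xpoly (entry C b) * F b)"
proof -
  have "(\<Sum>b\<in>Poly_Mapping.keys C. const_xpoly (entry C b) * F b) = (\<Sum>b\<in>K. const_xpoly (entry C b) * F b)"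
    using assms by (intro sum.mono_neutral_left) (auto simp: in_keys_iff const_xpoly_simps)
  then show ?thesis using assms unfolding expands_def by simp
qed

lemma expandsI:
  assumes "finite K" "Poly_Mapping.keys C \<subseteq> K" "Poly_Mapping.keys C \<subseteq> weak_compositions n"
    "f = (\<Sum>b\<in>K. const_xpoly (entry C b) * F b)"
  shows "expands n F f C"
proof -
  have "(\<Sum>b\<in>Poly_Mapping.keys C. const_xpoly (entry C b) * F b) = (\<Sum>b\<in>K. const_xpoly (entry C b) * F b)"
    using assms by (intro sum.mono_neutral_left) (auto simp: in_keys_iff const_xpoly_simps)
  then show ?thesis using assms unfolding expands_def by simp
qed

lemma expands_add:
  assumes "expands n F f C" "expands n F h D"
  shows "expands n F (f + h) (C + D)"
proof (rule expandsI)
  let ?K = "Poly_Mapping.keys C \<union> Poly_Mapping.keys D"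
  show "finite ?K" by simp
  show K: "Poly_Mapping.keys (C + D) \<subseteq> ?K" by (rule Poly_Mapping.keys_add)
  show "Poly_Mapping.keys (C + D) \<subseteq> weak_compositions n"
    using K assms unfolding expands_def by blast
  show "f + h = (\<Sum>b\<in>?K. const_xpoly (entry (C + D) b) * F b)"
    using expands_superset[OF assms(1), of ?K] expands_superset[OF assms(2), of ?K]
    by (simp add: lookup_add const_xpoly_simps distrib_right sum.distrib)
qed

text \<open>Coefficient families have the same type as polynomials, so multiplication by
  \<open>const_xpoly c\<close> scales every coefficient.\<close>

lemma expands_const_times:
  assumes "expands n F f C"
  shows "expands n F (const_xpoly c * f) (const_xpoly c * C)"
proof (rule expandsI)
  show "finite (Poly_Mapping.keys C)" by simp
  show K: "Poly_Mapping.keys (const_xpoly c * C) \<subseteq> Poly_Mapping.keys C"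
    by (auto simp: in_keys_iff)
  show "Poly_Mapping.keys (const_xpoly c * C) \<subseteq> weak_compositions n"
    using K assms unfolding expands_def by blast
  show "const_xpoly c * f = (\<Sum>b\<in>Poly_Mapping.keys C. const_xpoly (entry (const_xpoly c * C) b) * F b)"
    using expands_superset[OF assms, of "Poly_Mapping.keys C"]
    by (simp add: const_xpoly_simps sum_distrib_left mult.assoc)
qed

lemma expands_zero: "expands n F 0 0"
  by (simp add: expands_def)

lemma expands_ex_sum:
  assumes "finite I" "\<And>i. i \<in> I \<Longrightarrow> \<exists>C. expands n F (f i) C"
  shows "\<exists>C. expands n F (\<Sum>i\<in>I. f i) C"
  using assms by (induction I) (auto intro: expands_zero expands_add)

lemma poly_mapping_sum_keys:
  "(f :: xpoly) = (\<Sum>b\<in>Poly_Mapping.keys f. const_xpoly (entry f b) * Poly_Mapping.single b 1)"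
proof (rule poly_mapping_eqI)
  fix b
  have "entry (const_xpoly (entry f c) * Poly_Mapping.single c 1) b = (if c = b then entry f c else 0)" for c
    by (simp add: lookup_const_xpoly_times lookup_single when_def)
  then show "entry f b = entry (\<Sum>c\<in>Poly_Mapping.keys f. const_xpoly (entry f c) * Poly_Mapping.single c 1) b"
    by (simp add: lookup_sum in_keys_iff)
qed

text \<open>Well-founded induction on the lexicographic order: \<open>F a\<close> minus its leading
  monomial has only strictly smaller monomials, which expand by induction.\<close>

lemma unitriangular_single:
  assumes "unitriangular n F" "a \<in> weak_compositions n"
  shows "\<exists>C. expands n F (Poly_Mapping.single a 1) C"
  using assms(2)
proof (induction "weight_order n a" arbitrary: a rule: less_induct)
  case less
  let ?f = "F a - Poly_Mapping.single a 1"
  have keys: "b \<in> weak_compositions n \<and> weight_order n b < weight_order n a"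
    if "b \<in> Poly_Mapping.keys ?f" for b
    using that assms(1) less.prems unfolding unitriangular_def
    by (cases "b = a") (auto simp: in_keys_iff lookup_minus lookup_single)
  have "\<exists>C. expands n F (\<Sum>b\<in>Poly_Mapping.keys ?f. const_xpoly (entry ?f b) * Poly_Mapping.single b 1) C"
    using keys less.hyps by (intro expands_ex_sum) (simp, meson expands_const_times)
  then obtain C where "expands n F ?f C"
    using poly_mapping_sum_keys[of ?f] by auto
  from expands_const_times[OF this, of "-1"]
  have C: "expands n F (- ?f) (const_xpoly (-1) * C)"
    by (metis const_xpoly_def mult_minus1 one_poly_mapping_def single_uminus single_one)
  \<comment> \<open>Here \<open>Poly_Mapping.single a 1\<close> is a coefficient family, with value
    1 at the index \<open>a\<close>, and not a monomial.\<close>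
  have "expands n F (F a) (Poly_Mapping.single a 1)"
    using less.prems by (simp add: expands_def const_xpoly_def)
  from expands_add[OF C this] show ?case by auto
qed

lemma unitriangular_expands:
  assumes "unitriangular n F" "Poly_Mapping.keys f \<subseteq> weak_compositions n"
  shows "\<exists>C. expands n F f C"
proof -
  have "\<exists>C. expands n F (\<Sum>b\<in>Poly_Mapping.keys f. const_xpoly (entry f b) * Poly_Mapping.single b 1) C"
    using assms unitriangular_single[OF assms(1)]
    by (intro expands_ex_sum) (simp, meson expands_const_times subset_eq)
  then show ?thesis using poly_mapping_sum_keys[of f] by auto
qed

text \<open>Take an index \<open>a\<close> of maximal order in \<open>C\<close>. The monomial
  \<open>a\<close> occurs in no other \<open>F b\<close> of the sum, so its coefficient there is
  \<open>entry C a\<close>, which would have to vanish.\<close>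

lemma unitriangular_expands_zero:
  assumes "unitriangular n F" "expands n F 0 C"
  shows "C = 0"
proof (rule ccontr)
  assume "C \<noteq> 0"
  let ?K = "Poly_Mapping.keys C"
  have "Max (weight_order n ` ?K) \<in> weight_order n ` ?K"
    using \<open>C \<noteq> 0\<close> by (intro Max_in) auto
  then obtain a where a: "a \<in> ?K" "weight_order n a = Max (weight_order n ` ?K)"
    by auto
  have max: "\<not> weight_order n a < weight_order n b" if "b \<in> ?K" for b
    using that a by (simp add: leD)
  have K: "?K \<subseteq> weak_compositions n" using assms(2) by (simp add: expands_def)
  have "entry (F b) a = (if b = a then 1 else 0)" if "b \<in> ?K" for b
    using assms(1) K that max a unfolding unitriangular_def by fastforce
  then have "(\<Sum>b\<in>?K. entry C b * entry (F b) a) = (\<Sum>b\<in>?K. if b = a then entry C b else 0)"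
    by (intro sum.cong) auto
  then have "(\<Sum>b\<in>?K. entry C b * entry (F b) a) = entry C a"
    using a by simp
  moreover have "(0::xpoly) = (\<Sum>b\<in>?K. const_xpoly (entry C b) * F b)"
    using assms(2) by (simp add: expands_def)
  then have "0 = (\<Sum>b\<in>?K. entry C b * entry (F b) a)"
    by (metis (no_types, lifting) lookup_const_xpoly_times lookup_sum lookup_zero sum.cong)
  ultimately show False using a by (simp add: in_keys_iff)
qed

text \<open>The definite description in \<open>expansion\<close> denotes: an expansion exists, and
  two expansions of \<open>f\<close> differ by an expansion of 0.\<close>

lemma expansion_expands:
  assumes "unitriangular n F" "Poly_Mapping.keys f \<subseteq> weak_compositions n"
  shows "expands n F f (expansion n F f)"
proof -
  have "\<exists>!C. expands n F f C"
  proof (rule ex_ex1I)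
    show "\<exists>C. expands n F f C" by (rule unitriangular_expands[OF assms])
  next
    fix C D assume C: "expands n F f C" and D: "expands n F f D"
    from expands_add[OF C expands_const_times[OF D, of "-1"]]
    have "expands n F 0 (C + const_xpoly (-1) * D)"
      by (simp add: const_xpoly_def single_uminus)
    then have "C + const_xpoly (-1) * D = 0"
      by (rule unitriangular_expands_zero[OF assms(1)])
    moreover have "const_xpoly (-1) * D = - D"
      by (rule poly_mapping_eqI) simp
    ultimately show "C = D" by simp
  qed
  from theI'[OF this] show ?thesis
    by (simp add: expansion_def expands_def)
qed

text \<open>Reduces each of the two coefficient sums to finding a functional with value 1 on the
  whole family.\<close>

lemma coeff_sum_at_expansion_eq:
  assumes "unitriangular n F" "Poly_Mapping.keys f \<subseteq> weak_compositions n"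
    "\<And>b. b \<in> weak_compositions n \<Longrightarrow> beta_eval g (F b) = 1"
  shows "coeff_sum_at (-1) (expansion n F f) = beta_eval g f"
  using expansion_expands[OF assms(1,2)] assms(3) coeff_sum_at_expansion
  unfolding expands_def by blast


section \<open>Signed counts of mesonic glides\<close>

text \<open>Reindexing along the involution \<open>h\<close> turns the sum into its own
  negative.\<close>

lemma sum_eq_0_if_sign_reversing:
  fixes s :: "'a \<Rightarrow> int"
  assumes "\<And>x. x \<in> X \<Longrightarrow> h x \<in> X" "\<And>x. x \<in> X \<Longrightarrow> h (h x) = x"
    "\<And>x. x \<in> X \<Longrightarrow> s (h x) = - s x"
  shows "sum s X = 0"
proof -
  have "sum s X = (\<Sum>x\<in>X. - s x)"
    by (rule sum.reindex_bij_witness[where i = h and j = h]) (use assms in auto)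
  then show ?thesis by (simp add: sum_negf)
qed

text \<open>This is \<open>{1..Max S}\<close> for a finite nonempty \<open>S\<close> of positive numbers, and \<open>{}\<close> for \<open>S = {}\<close>.\<close>

definition initial_interval :: "nat set \<Rightarrow> nat set" where
  "initial_interval S = {t. 1 \<le> t \<and> (\<exists>s\<in>S. t \<le> s)}"

lemma finite_initial_interval: "finite S \<Longrightarrow> finite (initial_interval S)"
  by (rule finite_subset[of _ "{..Max S}"]) (auto simp: initial_interval_def intro: Max_ge order_trans)

text \<open>Every element of \<open>S'\<close> is bounded by one of \<open>S\<close>. Hence the
  supports of all monomials of one kaon or atom have the same initial interval.\<close>

lemma initial_interval_eqI:
  assumes "S \<subseteq> S'" "S' \<subseteq> initial_interval S"
  shows "initial_interval S' = initial_interval S"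
proof (intro equalityI subsetI)
  fix t assume "t \<in> initial_interval S'"
  then obtain s where s: "1 \<le> t" "s \<in> S'" "t \<le> s" by (auto simp: initial_interval_def)
  then obtain s' where "s' \<in> S" "s \<le> s'" using assms(2) by (auto simp: initial_interval_def)
  then have "t \<le> s'" using s by simp
  then show "t \<in> initial_interval S" using s \<open>s' \<in> S\<close> by (auto simp: initial_interval_def)
qed (use assms(1) in \<open>auto simp: initial_interval_def\<close>)

lemma weak_compositions_keys: "a \<in> weak_compositions n \<Longrightarrow> k \<in> Poly_Mapping.keys a \<Longrightarrow> 1 \<le> k \<and> k \<le> n"
  by (auto simp: weak_compositions_def)

lemma keys_subset_initial_interval: "a \<in> weak_compositions n \<Longrightarrow> Poly_Mapping.keys a \<subseteq> initial_interval (Poly_Mapping.keys a)"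
  by (auto simp: initial_interval_def dest: weak_compositions_keys)

lemma initial_interval_subset: "a \<in> weak_compositions n \<Longrightarrow> initial_interval (Poly_Mapping.keys a) \<subseteq> {1..n}"
  by (auto simp: initial_interval_def dest: weak_compositions_keys)

lemma finite_weak_compositions_bounded:
  "finite {b \<in> weak_compositions n. \<forall>i. entry b i \<le> N}" (is "finite ?B")
proof -
  let ?S = "{f. \<forall>x. (x \<in> {1..n} \<longrightarrow> f x \<in> {..N}) \<and> (x \<notin> {1..n} \<longrightarrow> f x = (0::nat))}"
  have "entry ` ?B \<subseteq> ?S"
    by (auto simp: weak_compositions_def in_keys_iff subset_iff)
  then have "finite (entry ` ?B)"
    by (rule finite_subset) (rule finite_set_of_finite_funs, auto)
  then show ?thesis
    by (rule finite_imageD) (auto intro: inj_onI poly_mapping_eqI)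
qed

text \<open>The block is that of the first nonzero position of \<open>a\<close> at or to the right
  of \<open>t\<close>.\<close>

lemma block_cover:
  assumes "t \<in> initial_interval (Poly_Mapping.keys a)"
  obtains p where "p \<in> Poly_Mapping.keys a" "t \<in> block a p"
proof -
  let ?P = "\<lambda>p. p \<in> Poly_Mapping.keys a \<and> t \<le> p"
  have ex: "\<exists>p. ?P p" using assms by (auto simp: initial_interval_def)
  have "t \<in> block a (Least ?P)"
    using assms LeastI_ex[OF ex] not_less_Least[of _ ?P]
    by (auto simp: block_def initial_interval_def in_keys_iff)
  then show ?thesis using that LeastI_ex[OF ex] by blast
qed

lemma block_disjoint:
  assumes "p \<in> Poly_Mapping.keys a" "q \<in> Poly_Mapping.keys a" "p \<noteq> q"
  shows "block a p \<inter> block a q = {}"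
proof -
  have "False" if "i \<in> block a p" "i \<in> block a q" for i
    using that assms by (cases p q rule: linorder_cases) (auto simp: block_def in_keys_iff)
  then show ?thesis by blast
qed

lemma finite_block [simp]: "finite (block a p)"
  by (rule finite_subset[of _ "{..p}"]) (auto simp: block_def)

lemma mem_block_self: "a \<in> weak_compositions n \<Longrightarrow> p \<in> Poly_Mapping.keys a \<Longrightarrow> p \<in> block a p"
  by (auto simp: block_def dest: weak_compositions_keys)

lemma block_inter_keys: "p \<in> Poly_Mapping.keys a \<Longrightarrow> block a p \<inter> Poly_Mapping.keys a \<subseteq> {p}"
  by (auto simp: block_def in_keys_iff)

lemma mesonic_glide_iff:
  "mesonic_glide n a (b, R) \<longleftrightarrow>
     b \<in> weak_compositions n \<and> R \<subseteq> Poly_Mapping.keys b \<and>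
     (\<forall>p\<in>Poly_Mapping.keys a.
        entry a p + card (R \<inter> block a p) = (\<Sum>i\<in>block a p. entry b i) \<and>
        (\<forall>i\<in>block a p.
           entry b i \<noteq> 0 \<and> (\<forall>k\<in>block a p. k < i \<longrightarrow> entry b k = 0) \<longrightarrow> i \<notin> R) \<and>
        entry b p \<noteq> 0) \<and>
     (\<forall>i. (\<forall>p\<in>Poly_Mapping.keys a. p < i) \<longrightarrow> entry b i = 0)"
  by (simp add: mesonic_glide_def weak_kompositions_def)

text \<open>The lower bound on the support comes from the nonzero entry at the right end of each
  block, the upper bound from the vanishing of \<open>b\<close> beyond the last block.\<close>

lemma mesonic_glide_keys:
  assumes "mesonic_glide n a (b, R)"
  shows "Poly_Mapping.keys a \<subseteq> Poly_Mapping.keys b" "Poly_Mapping.keys b \<subseteq> initial_interval (Poly_Mapping.keys a)"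
    "R \<subseteq> Poly_Mapping.keys b" "b \<in> weak_compositions n"
proof -
  note m = assms[unfolded mesonic_glide_iff]
  show "Poly_Mapping.keys a \<subseteq> Poly_Mapping.keys b" using m by (auto simp: in_keys_iff)
  show "Poly_Mapping.keys b \<subseteq> initial_interval (Poly_Mapping.keys a)"
  proof
    fix i assume i: "i \<in> Poly_Mapping.keys b"
    then have "\<not> (\<forall>p\<in>Poly_Mapping.keys a. p < i)" using m by (auto simp: in_keys_iff)
    then show "i \<in> initial_interval (Poly_Mapping.keys a)"
      using m i by (auto simp: initial_interval_def not_less dest: weak_compositions_keys)
  qed
qed (use assms mesonic_glide_iff in auto)

lemma finite_mesonic_glides: "finite {(b, R). mesonic_glide n a (b, R)}"
proof (rule finite_subset)
  \<comment> \<open>An entry is at most its block sum, which is one entry of \<open>a\<close> plus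
    the number of red entries in the block.\<close>
  let ?N = "(\<Sum>p\<in>Poly_Mapping.keys a. entry a p) + n"
  let ?B = "{b \<in> weak_compositions n. \<forall>i. entry b i \<le> ?N} \<times> Pow {1..n}"
  show "finite ?B" using finite_weak_compositions_bounded by auto
  show "{(b, R). mesonic_glide n a (b, R)} \<subseteq> ?B"
  proof
    fix x assume "x \<in> {(b, R). mesonic_glide n a (b, R)}"
    then obtain b R where x: "x = (b, R)" and m: "mesonic_glide n a (b, R)"
      by (cases x) simp
    note k = mesonic_glide_keys[OF m]
    have keys: "Poly_Mapping.keys b \<subseteq> {1..n}" using k(4) by (simp add: weak_compositions_def)
    have "entry b i \<le> ?N" for i
    proof (cases "i \<in> Poly_Mapping.keys b")
      case True
      then obtain p where p: "p \<in> Poly_Mapping.keys a" "i \<in> block a p"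
        using k(2) block_cover by blast
      have "entry b i \<le> (\<Sum>i\<in>block a p. entry b i)"
        using p by (intro member_le_sum) auto
      also have "\<dots> = entry a p + card (R \<inter> block a p)"
        using m p by (simp add: mesonic_glide_iff)
      also have "card (R \<inter> block a p) \<le> card {1..n}"
        using k(3) keys by (intro card_mono) auto
      also have "entry a p \<le> (\<Sum>p\<in>Poly_Mapping.keys a. entry a p)"
        using p by (intro member_le_sum) auto
      finally show ?thesis by simp
    qed (simp add: in_keys_iff)
    then show "x \<in> ?B" using k keys x by auto
  qed
qed

text \<open>Each block then has its right end as only nonzero position. Being leftmost, that entry
  is black, so the block has no excess and its sum forces the entry of \<open>a\<close>.\<close>

lemma mesonic_glide_same_keys:
  assumes a: "a \<in> weak_compositions n"
    and m: "mesonic_glide n a (b, R)" and k: "Poly_Mapping.keys b = Poly_Mapping.keys a"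
  shows "b = a" "R = {}"
proof -
  have p: "entry b p = entry a p \<and> p \<notin> R" if p: "p \<in> Poly_Mapping.keys a" for p
  proof -
    have z: "entry b i = 0" if "i \<in> block a p - {p}" for i
      using that block_inter_keys[OF p] k by (auto simp: in_keys_iff)
    have pb: "p \<in> block a p" by (rule mem_block_self[OF a p])
    have "p \<notin> R" using m p pb z by (auto simp: mesonic_glide_iff)
    then have "R \<inter> block a p = {}"
      using z mesonic_glide_keys(3)[OF m] by (auto simp: in_keys_iff)
    moreover have "(\<Sum>i\<in>block a p. entry b i) = entry b p"
      using z pb by (simp add: sum.remove)
    moreover have "entry a p + card (R \<inter> block a p) = (\<Sum>i\<in>block a p. entry b i)"
      using m p by (simp add: mesonic_glide_iff)
    ultimately show ?thesis using \<open>p \<notin> R\<close> by simp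
  qed
  show "b = a"
  proof (rule poly_mapping_eqI)
    fix i show "entry b i = entry a i"
      using p k by (cases "i \<in> Poly_Mapping.keys a") (auto simp: in_keys_iff)
  qed
  show "R = {}" using p k mesonic_glide_keys(3)[OF m] by auto
qed

lemma mesonic_glide_self:
  assumes a: "a \<in> weak_compositions n"
  shows "mesonic_glide n a (a, {})"
proof -
  have "(\<Sum>i\<in>block a p. entry a i) = entry a p" if p: "p \<in> Poly_Mapping.keys a" for p
  proof -
    have "entry a i = 0" if "i \<in> block a p - {p}" for i
      using that block_inter_keys[OF p] by (auto simp: in_keys_iff)
    then show ?thesis using mem_block_self[OF a p] by (simp add: sum.remove)
  qed
  then show ?thesis using a by (auto simp: mesonic_glide_iff in_keys_iff)
qed

section \<open>The recolouring involution on mesonic glides\<close>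

definition next_nonzero :: "nat \<Rightarrow> wcomp \<Rightarrow> nat" where
  "next_nonzero e b = (LEAST i. e < i \<and> entry b i \<noteq> 0)"

text \<open>
  Let \<open>e\<close> be the leftmost position of its block that may be occupied, \<open>e\<close> not being the right end of
  the block. Then the entry at \<open>e\<close> is zero or black. If the next nonzero entry, at position \<open>f\<close>, is
  red, then \<open>b\<^sub>e \<ge> 1\<close>, so recolouring it black can be compensated by decrementing \<open>b\<^sub>e\<close>, possibly to \<open>0\<close>,
  in which case the now black entry at \<open>f\<close> becomes the leftmost one.
\<close>

definition toggle_colour :: "nat \<Rightarrow> wkomp \<Rightarrow> wkomp" where
  "toggle_colour e = (\<lambda>(b, R). let f = next_nonzero e b in
     if f \<in> R then (Poly_Mapping.update e (entry b e - 1) b, R - {f})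
     else (Poly_Mapping.update e (entry b e + 1) b, insert f R))"

text \<open>The search starts strictly to the right of \<open>e\<close>, so toggling twice uses the
  same position.\<close>

lemma next_nonzero_update: "next_nonzero e (Poly_Mapping.update e x b) = next_nonzero e b"
  unfolding next_nonzero_def by (rule arg_cong[where f = Least]) (auto simp: lookup_update)

text \<open>Stated additively to stay clear of truncated subtraction.\<close>

lemma sum_update_block:
  assumes "e \<in> B" "finite B"
  shows "(\<Sum>i\<in>B. entry (Poly_Mapping.update e x b) i) + entry b e = (\<Sum>i\<in>B. entry b i) + (x::nat)"
proof -
  have "(\<Sum>i\<in>B - {e}. entry (Poly_Mapping.update e x b) i) = (\<Sum>i\<in>B - {e}. entry b i)"
    by (intro sum.cong) (auto simp: lookup_update)
  then show ?thesis using assms by (simp add: sum.remove[of B e] lookup_update)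
qed

context
  fixes n :: nat and a :: wcomp and T :: "nat set" and p e :: nat
  assumes a: "a \<in> weak_compositions n"
    and T: "Poly_Mapping.keys a \<subseteq> T" "T \<subseteq> {1..n}"
    and p: "p \<in> Poly_Mapping.keys a"
    and e: "e \<in> T" "e \<in> block a p" "e < p" "\<And>i. i \<in> T \<Longrightarrow> i \<in> block a p \<Longrightarrow> e \<le> i"
begin

text \<open>The block sum and the number of red entries in the block change together by one. This
  preserves the sum condition and flips the sign.\<close>

lemma toggle_colour:
  assumes m: "mesonic_glide n a (b, R)" and bT: "Poly_Mapping.keys b \<subseteq> T"
    and eq: "toggle_colour e (b, R) = (b', R')"
  shows "mesonic_glide n a (b', R')" "Poly_Mapping.keys b' \<subseteq> T" "toggle_colour e (b', R') = (b, R)"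
    "(-1 :: int) ^ card R' = - ((-1) ^ card R)"
proof -
  define f where "f = next_nonzero e b"
  note mg = m[unfolded mesonic_glide_iff]
  note k = mesonic_glide_keys[OF m]
  have pb: "entry b p \<noteq> 0" using mg p by auto
  have f: "e < f" "entry b f \<noteq> 0"
    using LeastI[of "\<lambda>i. e < i \<and> entry b i \<noteq> 0" p] pb e(3) by (auto simp: f_def next_nonzero_def)
  have f_least: "entry b i = 0" if "e < i" "i < f" for i
    using not_less_Least[of i "\<lambda>i. e < i \<and> entry b i \<noteq> 0"] that by (auto simp: f_def next_nonzero_def)
  have fp: "f \<le> p" using f_least pb e(3) not_less by blast
  have fB: "f \<in> block a p" using e(2) f fp by (auto simp: block_def)
  \<comment> \<open>Positions of the block to the left of \<open>e\<close> lie outside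
    \<open>T\<close>, since \<open>e\<close> is the least position of \<open>T\<close> in the
    block.\<close>
  have below: "entry b i = 0" if "i \<in> block a p" "i < e" for i
    using e(4)[of i] bT that by (auto simp: in_keys_iff)
  have lead: "i \<notin> R" if "q \<in> Poly_Mapping.keys a" "i \<in> block a q" "entry b i \<noteq> 0"
    "\<And>k. k \<in> block a q \<Longrightarrow> k < i \<Longrightarrow> entry b k = 0" for q i
    using mg that by simp
  have finR: "finite R" using k(3) by (rule finite_subset) simp
  have eR: "e \<notin> R"
  proof
    assume "e \<in> R"
    then show False using lead[OF p e(2)] below k(3) by (auto simp: in_keys_iff)
  qed
  have e_pos: "entry b e \<noteq> 0" if "f \<in> R"
  proof
    assume z: "entry b e = 0"
    have "entry b i = 0" if "i \<in> block a p" "i < f" for i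
      using z below[of i] f_least[of i] that by (cases i e rule: linorder_cases) auto
    then show False using lead[OF p fB] f \<open>f \<in> R\<close> by simp
  qed
  have fe: "f \<noteq> e" "f \<noteq> 0" using f by auto
  \<comment> \<open>The subtraction is exact: in that case \<open>e_pos\<close> makes the entry at
    \<open>e\<close> nonzero.\<close>
  define x where "x = (if f \<in> R then entry b e - 1 else entry b e + 1)"
  have b': "b' = Poly_Mapping.update e x b" and R': "R' = (if f \<in> R then R - {f} else insert f R)"
    using eq by (auto simp: toggle_colour_def f_def x_def Let_def split: if_splits)
  have lk: "entry b' i = (if i = e then x else entry b i)" for i
    by (simp add: b' lookup_update)
  have keys': "i = e \<or> i \<in> Poly_Mapping.keys b" if "i \<in> Poly_Mapping.keys b'" for i
    using that by (simp add: in_keys_iff lk split: if_splits)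
  show kT: "Poly_Mapping.keys b' \<subseteq> T" using keys' e(1) bT by blast
  have nz: "next_nonzero e b' = f" by (simp add: b' next_nonzero_update f_def)
  show "toggle_colour e (b', R') = (b, R)"
  proof -
    have "Poly_Mapping.update e (entry b e) b' = b"
      by (rule poly_mapping_eqI) (simp add: lookup_update lk)
    then show ?thesis
      using e_pos fe by (auto simp: toggle_colour_def Let_def nz R' lk x_def)
  qed
  show "(-1 :: int) ^ card R' = - ((-1) ^ card R)"
  proof (cases "f \<in> R")
    case True
    then have "card R = Suc (card R')" using finR by (simp add: R' card.remove del: card_Diff_insert)
    then show ?thesis by simp
  qed (use finR in \<open>simp add: R'\<close>)
  show "mesonic_glide n a (b', R')"
    unfolding mesonic_glide_iff
  proof (intro conjI ballI allI impI)
    show "b' \<in> weak_compositions n" using kT T by (auto simp: weak_compositions_def)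
    show "R' \<subseteq> Poly_Mapping.keys b'"
    proof
      fix i assume "i \<in> R'"
      then have "i = f \<or> i \<in> R" by (auto simp: R' split: if_splits)
      then have "i \<noteq> e" "entry b i \<noteq> 0" using f eR fe k(3) by (auto simp: in_keys_iff)
      then show "i \<in> Poly_Mapping.keys b'" by (simp add: lk in_keys_iff)
    qed
  next
    fix q assume q: "q \<in> Poly_Mapping.keys a"
    \<comment> \<open>The position \<open>e\<close> is not the right end of any block, because
      \<open>a\<close> vanishes in \<open>block a p\<close> to the left of \<open>p\<close>.\<close>
    show "entry b' q \<noteq> 0"
      using q mg p e(2,3) by (auto simp: lk block_def in_keys_iff)
    show "entry a q + card (R' \<inter> block a q) = (\<Sum>i\<in>block a q. entry b' i)"
    proof (cases "q = p")
      case False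
      then have "block a q \<inter> block a p = {}" using block_disjoint p q by blast
      then have "R' \<inter> block a q = R \<inter> block a q" "e \<notin> block a q"
        using fB e(2) by (auto simp: R')
      then have "(\<Sum>i\<in>block a q. entry b' i) = (\<Sum>i\<in>block a q. entry b i)"
        by (intro sum.cong) (auto simp: lk)
      then show ?thesis using mg q \<open>R' \<inter> block a q = R \<inter> block a q\<close> by simp
    next
      case True
      have s: "(\<Sum>i\<in>block a p. entry b' i) + entry b e = (\<Sum>i\<in>block a p. entry b i) + x"
        unfolding b' by (rule sum_update_block) (use e in auto)
      have c: "entry a p + card (R \<inter> block a p) = (\<Sum>i\<in>block a p. entry b i)"
        using mg p by simp
      show ?thesis
      proof (cases "f \<in> R")
        case f: True
        have "R' \<inter> block a p = (R \<inter> block a p) - {f}" using f by (auto simp: R')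
        moreover have "card (R \<inter> block a p) = Suc (card ((R \<inter> block a p) - {f}))"
          using f fB finR by (intro card.remove) auto
        ultimately show ?thesis using s c e_pos f True by (simp add: x_def)
      next
        case f: False
        have "R' \<inter> block a p = insert f (R \<inter> block a p)" using f fB by (auto simp: R')
        then have "card (R' \<inter> block a p) = Suc (card (R \<inter> block a p))"
          using f finR by simp
        then show ?thesis using s c f True by (simp add: x_def)
      qed
    qed
    fix i assume i: "i \<in> block a q" and lm: "entry b' i \<noteq> 0 \<and> (\<forall>k\<in>block a q. k < i \<longrightarrow> entry b' k = 0)"
    show "i \<notin> R'"
    proof
      assume iR: "i \<in> R'"
      show False
      proof (cases "q = p")
        case False
        then have "block a q \<inter> block a p = {}" using block_disjoint p q by blast
        then have ne: "e \<notin> block a q" "f \<notin> block a q" using fB e(2) by auto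
        then have "i \<in> R" using iR i by (auto simp: R' split: if_splits)
        moreover have "i \<noteq> e" using ne i by auto
        then have "entry b i \<noteq> 0" using lm by (simp add: lk)
        moreover have "entry b j = 0" if "j \<in> block a q" "j < i" for j
        proof -
          have "entry b' j = 0" using lm that by blast
          moreover have "j \<noteq> e" using ne that by auto
          ultimately show ?thesis by (simp add: lk)
        qed
        ultimately show False using lead[OF q i] by simp
      next
        case True
        have "e \<le> i"
          using True i iR e(4)[of i] k(3) bT f by (auto simp: R' split: if_splits)
        moreover have "i \<noteq> e" using iR eR fe by (auto simp: R' split: if_splits)
        ultimately have ei: "e < i" by simp
        \<comment> \<open>Something nonzero lies to the left of \<open>i\<close> in the block: the
          recoloured entry at \<open>f\<close> if \<open>f\<close> was red, and otherwise the
          incremented entry at \<open>e\<close>.\<close>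
        show False
        proof (cases "f \<in> R")
          case fR: True
          have "i \<noteq> f" "i \<in> R" using iR fR by (auto simp: R')
          then have "entry b i \<noteq> 0" using k(3) by (auto simp: in_keys_iff)
          then have "f < i" using f_least[OF ei] \<open>i \<noteq> f\<close> by (meson linorder_neqE_nat)
          then show False using lm fB f True fe by (auto simp: lk)
        next
          case False
          then show False using lm ei e(2) True by (auto simp: lk x_def)
        qed
      qed
    qed
  next
    fix i assume "\<forall>q\<in>Poly_Mapping.keys a. q < i"
    then show "entry b' i = 0" using mg p e(3) by (auto simp: lk)
  qed
qed

end

definition glide_count :: "nat \<Rightarrow> wcomp \<Rightarrow> nat set \<Rightarrow> int" where
  "glide_count n a T = (\<Sum>(b, R) | mesonic_glide n a (b, R) \<and> Poly_Mapping.keys b \<subseteq> T. (-1) ^ card R)"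

text \<open>For \<open>T\<close> equal to the support only the uncoloured \<open>a\<close> itself is
  counted. Otherwise some block contains a further element of \<open>T\<close>, and toggling in that
  block cancels everything.\<close>

lemma glide_count:
  assumes a: "a \<in> weak_compositions n"
    and T: "Poly_Mapping.keys a \<subseteq> T" "T \<subseteq> initial_interval (Poly_Mapping.keys a)"
  shows "glide_count n a T = (if T = Poly_Mapping.keys a then 1 else 0)"
proof (cases "T = Poly_Mapping.keys a")
  case True
  have "{(b, R). mesonic_glide n a (b, R) \<and> Poly_Mapping.keys b \<subseteq> T} = {(a, {})}"
  proof (intro equalityI subsetI; clarify)
    fix b R assume m: "mesonic_glide n a (b, R)" and "Poly_Mapping.keys b \<subseteq> T"
    then have "Poly_Mapping.keys b = Poly_Mapping.keys a"
      using mesonic_glide_keys(1)[OF m] True by auto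
    then show "b = a \<and> R = {}" using mesonic_glide_same_keys[OF a m] by simp
  next
    show "mesonic_glide n a (a, {}) \<and> Poly_Mapping.keys a \<subseteq> T"
      using mesonic_glide_self[OF a] T by simp
  qed
  then show ?thesis using True by (simp add: glide_count_def)
next
  case False
  then obtain t where t: "t \<in> T" "t \<notin> Poly_Mapping.keys a" using T by blast
  then obtain p where p: "p \<in> Poly_Mapping.keys a" "t \<in> block a p" using block_cover T by blast
  \<comment> \<open>This position depends on \<open>T\<close> and the block only, not on the glide,
    so all glides are toggled at the same \<open>e\<close>.\<close>
  define e where "e = Min (T \<inter> block a p)"
  have "e \<in> T \<inter> block a p" unfolding e_def using t p by (intro Min_in) auto
  then have e: "e \<in> T" "e \<in> block a p" by auto
  have e_least: "e \<le> i" if "i \<in> T" "i \<in> block a p" for i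
    unfolding e_def using that by (intro Min_le) auto
  have "t < p" using t p by (metis (mono_tags, lifting) block_def le_neq_implies_less mem_Collect_eq)
  then have ep: "e < p" using e_least[OF t(1) p(2)] by simp
  have Tn: "T \<subseteq> {1..n}" using T initial_interval_subset[OF a] by blast
  note tc = toggle_colour[OF a T(1) Tn p(1) e ep e_least]
  have "(\<Sum>x\<in>{(b, R). mesonic_glide n a (b, R) \<and> Poly_Mapping.keys b \<subseteq> T}. case x of (b, R) \<Rightarrow> (-1::int) ^ card R) = 0"
  proof (rule sum_eq_0_if_sign_reversing[where h = "toggle_colour e"])
    fix x assume x: "x \<in> {(b, R). mesonic_glide n a (b, R) \<and> Poly_Mapping.keys b \<subseteq> T}"
    obtain b R b' R' where [simp]: "x = (b, R)" and eq: "toggle_colour e (b, R) = (b', R')"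
      by (meson surj_pair)
    have "mesonic_glide n a (b, R)" "Poly_Mapping.keys b \<subseteq> T" using x by auto
    note c = tc[OF _ _ this eq]
    show "toggle_colour e x \<in> {(b, R). mesonic_glide n a (b, R) \<and> Poly_Mapping.keys b \<subseteq> T}"
      using c eq by simp
    show "toggle_colour e (toggle_colour e x) = x" using c eq by simp
    show "(case toggle_colour e x of (b, R) \<Rightarrow> (-1::int) ^ card R) = - (case x of (b, R) \<Rightarrow> (-1) ^ card R)"
      using c eq by simp
  qed
  then show ?thesis using False by (simp add: glide_count_def)
qed

text \<open>Every glide other than \<open>(a, {})\<close> has strictly larger support, which lowers
  the first component of \<open>weight_order\<close>.\<close>

lemma unitriangular_kaon: "unitriangular n (kaon n)"
  unfolding unitriangular_def
proof (intro ballI conjI allI impI)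
  fix a assume a: "a \<in> weak_compositions n"
  let ?G = "{(b, R). mesonic_glide n a (b, R)}"
  have lk: "entry (kaon n a) c = (\<Sum>(b, R)\<in>?G. if b = c then monom 1 (card R) else 0)" for c
    unfolding kaon_def lookup_sum
    by (intro sum.cong) (auto simp: beta_monomial_def lookup_single when_def)
  have "entry (kaon n a) a = (\<Sum>(b, R)\<in>{(a, {} :: nat set)}. if b = a then monom 1 (card R) else 0)"
    unfolding lk
  proof (rule sum.mono_neutral_right[OF finite_mesonic_glides])
    show "{(a, {})} \<subseteq> ?G" using mesonic_glide_self[OF a] by simp
    show "\<forall>x\<in>?G - {(a, {})}. (case x of (b, R) \<Rightarrow> if b = a then monom 1 (card R) else 0) = (0 :: int poly)"
      by (auto split: if_splits dest!: mesonic_glide_same_keys(2)[OF a _ refl])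
  qed
  then show "entry (kaon n a) a = 1" by simp
  fix c assume c: "c \<noteq> a" "entry (kaon n a) c \<noteq> 0"
  have "\<exists>R. mesonic_glide n a (c, R)"
  proof (rule ccontr)
    assume "\<not> ?thesis"
    then have "entry (kaon n a) c = 0" unfolding lk by (intro sum.neutral) auto
    with c show False by simp
  qed
  then obtain R where m: "mesonic_glide n a (c, R)" ..
  note k = mesonic_glide_keys[OF m]
  have "Poly_Mapping.keys a \<subset> Poly_Mapping.keys c"
    using k(1) mesonic_glide_same_keys(1)[OF a m] c by auto
  then have "card (Poly_Mapping.keys a) < card (Poly_Mapping.keys c)"
    by (intro psubset_card_mono) auto
  moreover have "card (Poly_Mapping.keys c) \<le> card {1..n}"
    using k(4) by (intro card_mono) (auto simp: weak_compositions_def)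
  ultimately have "n - card (Poly_Mapping.keys c) < n - card (Poly_Mapping.keys a)"
    by simp
  then show "weight_order n c < weight_order n a"
    by (simp add: weight_order_def less_prod_def)
  show "c \<in> weak_compositions n" by (rule k(4))
qed


section \<open>Signed counts of semistandard fillings\<close>

lemma mem_diagram: "(r, c) \<in> diagram a \<longleftrightarrow> 1 \<le> c \<and> c \<le> entry a r"
  by (auto simp: diagram_def in_keys_iff)

lemma finite_diagram [simp]: "finite (diagram a)"
  by (simp add: diagram_def)

lemma card_diagram: "card (diagram a) = wsize a"
  by (simp add: diagram_def wsize_def)

lemma sorted_wrt_sorted_list_of_set:
  assumes "finite (S :: 'a :: linorder set)"
  shows "sorted_wrt P (sorted_list_of_set S) \<longleftrightarrow> (\<forall>x\<in>S. \<forall>y\<in>S. x < y \<longrightarrow> P x y)"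
proof -
  let ?l = "sorted_list_of_set S"
  have s: "sorted_wrt (<) ?l" by simp
  have S: "set ?l = S" using assms by simp
  show ?thesis
  proof
    assume P: "sorted_wrt P ?l"
    show "\<forall>x\<in>S. \<forall>y\<in>S. x < y \<longrightarrow> P x y"
    proof (intro ballI impI)
      fix x y assume "x \<in> S" "y \<in> S" "x < y"
      then have "x \<in> set ?l" "y \<in> set ?l" using S by simp_all
      then obtain i j where ij: "i < length ?l" "?l ! i = x" "j < length ?l" "?l ! j = y"
        by (auto simp only: in_set_conv_nth)
      then have "i < j"
        using s \<open>x < y\<close> unfolding sorted_wrt_iff_nth_less
        by (metis linorder_neqE_nat not_less_iff_gr_or_eq)
      then show "P x y" using P ij unfolding sorted_wrt_iff_nth_less by blast
    qed
  next
    assume "\<forall>x\<in>S. \<forall>y\<in>S. x < y \<longrightarrow> P x y"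
    then show "sorted_wrt P ?l"
      using s sorted_wrt_mono_rel[of ?l "(<)" P] by (simp add: assms)
  qed
qed

lemma sorted_flat_iff:
  "sorted_wrt (\<ge>) (flat a) \<longleftrightarrow>
     (\<forall>r\<in>Poly_Mapping.keys a. \<forall>r'\<in>Poly_Mapping.keys a. r < r' \<longrightarrow> entry a r' \<le> entry a r)"
  by (simp add: flat_def sorted_wrt_map sorted_wrt_sorted_list_of_set)

text \<open>At a least point moved down, its image is already fixed, against injectivity. Applied
  below to the anchors of one column.\<close>

lemma inj_le_imp_id:
  fixes f :: "nat \<Rightarrow> nat"
  assumes "inj_on f A" "\<And>x. x \<in> A \<Longrightarrow> f x \<in> A" "\<And>x. x \<in> A \<Longrightarrow> f x \<le> x" "x \<in> A"
  shows "f x = x"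
  using assms(4)
proof (induction x rule: less_induct)
  case (less x)
  show ?case
  proof (rule ccontr)
    assume "f x \<noteq> x"
    then have "f x < x" using assms(3)[OF less.prems] by simp
    then have "f (f x) = f x" using less.IH assms(2)[OF less.prems] by simp
    then show False using assms(1,2) less.prems \<open>f x \<noteq> x\<close> by (meson inj_onD)
  qed
qed

text \<open>Since boxes are finite and nonempty, the minimum in (S.2) can be replaced by a
  quantifier over the entries.\<close>

lemma SSF_iff:
  "F \<in> SSF a \<longleftrightarrow>
     (\<forall>r c. (r, c) \<in> diagram a \<longrightarrow> F r c \<noteq> {} \<and> finite (F r c) \<and> 0 \<notin> F r c) \<and>
     (\<forall>r c. (r, c) \<notin> diagram a \<longrightarrow> F r c = {}) \<and>
     columns_distinct a F \<and>
     (\<forall>r c. (r, c) \<in> diagram a \<longrightarrow> (r, Suc c) \<in> diagram a \<longrightarrow> (\<forall>e\<in>F r c. anchor F r (Suc c) \<le> e)) \<and>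
     triple_condition a F \<and> free_entries_minimal a F \<and> (\<forall>r. (r, 1) \<in> diagram a \<longrightarrow> anchor F r 1 = r)"
  (is "_ \<longleftrightarrow> ?B \<and> ?E \<and> ?C \<and> ?R \<and> ?S")
proof -
  have "set_valued_filling a F \<longleftrightarrow> ?B \<and> ?E"
    by (auto simp: set_valued_filling_def)
  moreover have "rows_decreasing a F \<longleftrightarrow> ?R" if ?B
    using that by (fastforce simp: rows_decreasing_def)
  ultimately show ?thesis by (auto simp: SSF_def semistandard_def)
qed

lemma SSF_D:
  assumes "F \<in> SSF a"
  shows "(r, c) \<in> diagram a \<Longrightarrow> F r c \<noteq> {}" "finite (F r c)" "0 \<notin> F r c"
    "(r, c) \<notin> diagram a \<Longrightarrow> F r c = {}"
    "(r, c) \<in> diagram a \<Longrightarrow> anchor F r c \<in> F r c"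
    "(r, c) \<in> diagram a \<Longrightarrow> (r, Suc c) \<in> diagram a \<Longrightarrow> e \<in> F r c \<Longrightarrow> anchor F r (Suc c) \<le> e"
    "(r, 1) \<in> diagram a \<Longrightarrow> anchor F r 1 = r"
    "e \<in> F r c \<Longrightarrow> e \<le> anchor F r c"
    "e \<in> F r c \<Longrightarrow> e \<in> F r' c \<Longrightarrow> r = r'"
    "e \<in> F r c \<Longrightarrow> (r, c) \<in> diagram a"
proof -
  note F = assms[unfolded SSF_iff]
  show b: "(r, c) \<in> diagram a \<Longrightarrow> F r c \<noteq> {}" and f: "finite (F r c)" and "0 \<notin> F r c"
    and e: "(r, c) \<notin> diagram a \<Longrightarrow> F r c = {}" for r c
    using F by (cases "(r, c) \<in> diagram a"; auto)+
  show "(r, c) \<in> diagram a \<Longrightarrow> anchor F r c \<in> F r c" using b f by simp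
  show "e \<in> F r c \<Longrightarrow> e \<le> anchor F r c" using f by simp
  show d: "e \<in> F r c \<Longrightarrow> (r, c) \<in> diagram a" for r using e by auto
  show "e \<in> F r c \<Longrightarrow> e \<in> F r' c \<Longrightarrow> r = r'"
    using F d unfolding columns_distinct_def by blast
qed (use assms[unfolded SSF_iff] in auto)

text \<open>Anchors start at the row index by (S.5) and weakly decrease along the row.\<close>

lemma SSF_anchor_le:
  assumes F: "F \<in> SSF a" and "(r, c) \<in> diagram a"
  shows "anchor F r c \<le> r"
  using assms(2)
proof (induction c)
  case (Suc c)
  show ?case
  proof (cases "c = 0")
    case True
    then show ?thesis using SSF_D(7)[OF F, of r] Suc.prems by simp
  next
    case False
    then have d: "(r, c) \<in> diagram a" using Suc.prems by (simp add: mem_diagram)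
    have "anchor F r (Suc c) \<le> anchor F r c"
      using SSF_D(6)[OF F d Suc.prems SSF_D(5)[OF F d]] .
    then show ?thesis using Suc.IH[OF d] by simp
  qed
qed (simp add: mem_diagram)

lemma SSF_entries:
  assumes F: "F \<in> SSF a"
  shows "F r c \<subseteq> initial_interval (Poly_Mapping.keys a)"
proof
  fix e assume e: "e \<in> F r c"
  note d = SSF_D(10)[OF F e]
  have "e \<le> r" using SSF_D(8)[OF F e] SSF_anchor_le[OF F d] by simp
  moreover have "e \<noteq> 0" using SSF_D(3)[OF F] e by metis
  moreover have "r \<in> Poly_Mapping.keys a" using d by (auto simp: mem_diagram in_keys_iff)
  ultimately show "e \<in> initial_interval (Poly_Mapping.keys a)" by (auto simp: initial_interval_def)
qed

text \<open>A filling is encoded by its set of pairs of a box and an entry, a subset of a finite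
  product.\<close>

lemma finite_SSF: "finite (SSF a)"
proof -
  let ?g = "\<lambda>F :: filling. {(p, e). e \<in> F (fst p) (snd p)}"
  have "?g ` SSF a \<subseteq> Pow (diagram a \<times> initial_interval (Poly_Mapping.keys a))"
    using SSF_entries SSF_D(10) by fastforce
  then have "finite (?g ` SSF a)"
    by (rule finite_subset) (simp add: finite_initial_interval)
  moreover have "inj_on ?g (SSF a)"
  proof (rule inj_onI, intro ext)
    fix F G r c assume "?g F = ?g G"
    then have "((r, c), e) \<in> ?g F \<longleftrightarrow> ((r, c), e) \<in> ?g G" for e by simp
    then show "F r c = G r c" by auto
  qed
  ultimately show ?thesis by (rule finite_imageD)
qed

section \<open>The involution toggling free entries\<close>

text \<open>
  A pair \<open>(c, e)\<close> is available if \<open>e\<close> may occur as a free entry of column \<open>c\<close>. By (S.4) its box is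
  then forced, and availability depends on the anchors only, so each available pair may be toggled.
\<close>

definition available :: "wcomp \<Rightarrow> nat set \<Rightarrow> filling \<Rightarrow> (nat \<times> nat) set" where
  "available a T F = {(c, e). e \<in> T \<and> (\<forall>r. (r, c) \<in> diagram a \<longrightarrow> anchor F r c \<noteq> e) \<and>
     (\<exists>r. free_entry_fits a F e r c)}"

definition lowest_fit :: "wcomp \<Rightarrow> filling \<Rightarrow> nat \<Rightarrow> nat \<Rightarrow> nat" where
  "lowest_fit a F c e = (SOME r. free_entry_fits a F e r c \<and>
     (\<forall>r'. free_entry_fits a F e r' c \<longrightarrow> anchor F r c \<le> anchor F r' c))"

definition toggle_entry :: "filling \<Rightarrow> nat \<Rightarrow> nat \<Rightarrow> nat \<Rightarrow> filling" where
  "toggle_entry F r c e = F(r := (F r)(c := if e \<in> F r c then F r c - {e} else insert e (F r c)))"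

text \<open>Both choices, of the pair and of the row, depend on the filling only through its
  anchors. Toggling preserves these, so a second application makes the same choices.\<close>

definition toggle_available :: "wcomp \<Rightarrow> nat set \<Rightarrow> filling \<Rightarrow> filling" where
  "toggle_available a T F =
     (let (c, e) = (SOME x. x \<in> available a T F) in toggle_entry F (lowest_fit a F c e) c e)"

lemma lowest_fit:
  assumes "free_entry_fits a F e r c"
  shows "free_entry_fits a F e (lowest_fit a F c e) c"
    "free_entry_fits a F e r' c \<Longrightarrow> anchor F (lowest_fit a F c e) c \<le> anchor F r' c"
proof -
  obtain r0 where "free_entry_fits a F e r0 c \<and>
     (\<forall>r'. free_entry_fits a F e r' c \<longrightarrow> anchor F r0 c \<le> anchor F r' c)"
    using ex_has_least_nat[of "\<lambda>r. free_entry_fits a F e r c", OF assms, of "\<lambda>r. anchor F r c"] by blast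
  from someI[of "\<lambda>r. free_entry_fits a F e r c \<and>
     (\<forall>r'. free_entry_fits a F e r' c \<longrightarrow> anchor F r c \<le> anchor F r' c)", OF this]
  show "free_entry_fits a F e (lowest_fit a F c e) c"
    "free_entry_fits a F e r' c \<Longrightarrow> anchor F (lowest_fit a F c e) c \<le> anchor F r' c"
    unfolding lowest_fit_def by auto
qed

lemma free_entry_fits_self:
  assumes F: "F \<in> SSF a" and e: "e \<in> F r c" "e \<noteq> anchor F r c"
  shows "free_entry_fits a F e r c"
  using SSF_D(10)[OF F e(1)] SSF_D(6)[OF F _ _ e(1)] SSF_D(8)[OF F e(1)] e(2)
  by (auto simp: free_entry_fits_def)

context
  fixes a :: wcomp and F F' :: filling and r c e :: nat
  assumes F: "F \<in> SSF a"
    and e: "e \<noteq> 0" "\<And>r. (r, c) \<in> diagram a \<Longrightarrow> anchor F r c \<noteq> e"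
    and r: "free_entry_fits a F e r c"
      "\<And>r'. free_entry_fits a F e r' c \<Longrightarrow> anchor F r c \<le> anchor F r' c"
    and F': "F' = toggle_entry F r c e"
begin

lemma toggle_entry_box: "(r, c) \<in> diagram a" "e < anchor F r c"
  using r(1) by (auto simp: free_entry_fits_def)

text \<open>The value \<open>e\<close> lies strictly below the anchor of its box, so inserting or
  removing it keeps the maximum.\<close>

lemma toggle_entry_anchor: "anchor F' r' c' = anchor F r' c'"
proof (cases "r' = r \<and> c' = c")
  case True
  note b = toggle_entry_box
  have m: "anchor F r c \<in> F r c" using SSF_D(5)[OF F b(1)] .
  have "Max (F' r c) = anchor F r c"
    by (rule Max_eqI) (use b m SSF_D(2,8)[OF F] in \<open>auto simp: F' toggle_entry_def split: if_splits\<close>)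
  then show ?thesis using True by simp
qed (auto simp: F' toggle_entry_def)

lemma toggle_entry_fits: "free_entry_fits a F' = free_entry_fits a F"
  by (intro ext) (simp add: free_entry_fits_def toggle_entry_anchor)

text \<open>An occurrence of \<open>e\<close> in column \<open>c\<close> is free. By (S.4) and the
  minimality of row \<open>r\<close> its box has the same anchor as the box in row \<open>r\<close>,
  so (S.1) identifies the rows.\<close>

lemma toggle_entry_unique: "e \<in> F r' c \<Longrightarrow> r' = r"
proof -
  assume m: "e \<in> F r' c"
  note d = SSF_D(10)[OF F m]
  have ne: "e \<noteq> anchor F r' c" using e(2)[OF d] by simp
  have "anchor F r' c \<le> anchor F r c"
    using F m ne d r(1) unfolding SSF_iff free_entries_minimal_def by blast
  moreover have "anchor F r c \<le> anchor F r' c"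
    using r(2) free_entry_fits_self[OF F m ne] .
  ultimately have "anchor F r c \<in> F r' c" using SSF_D(5)[OF F d] by simp
  then show "r' = r" using SSF_D(9)[OF F] SSF_D(5)[OF F toggle_entry_box(1)] by metis
qed

lemma toggle_entry_mem: "x \<in> F' r' c' \<longleftrightarrow>
    (if r' = r \<and> c' = c \<and> x = e then e \<notin> F r c else x \<in> F r' c')"
  by (auto simp: F' toggle_entry_def)

text \<open>(S.3) and (S.5) only see anchors. For the toggled entry, (S.1) is
  \<open>toggle_entry_unique\<close>, (S.2) holds because \<open>e\<close> fits, and (S.4) because
  row \<open>r\<close> is minimal.\<close>

lemma toggle_entry_SSF: "F' \<in> SSF a"
  unfolding SSF_iff toggle_entry_anchor
proof (intro conjI allI impI ballI)
  note b = toggle_entry_box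
  show "F' r' c' \<noteq> {}" if "(r', c') \<in> diagram a" for r' c'
    using SSF_D(5)[OF F that] b toggle_entry_mem[of "anchor F r' c'" r' c'] by (auto split: if_splits)
  show "finite (F' r' c')" for r' c'
    using SSF_D(2)[OF F] by (simp add: F' toggle_entry_def)
  show "0 \<notin> F' r' c'" for r' c'
    using SSF_D(3)[OF F] e(1) toggle_entry_mem by (auto split: if_splits)
  show "F' r' c' = {}" if "(r', c') \<notin> diagram a" for r' c'
    using SSF_D(4)[OF F that] that b by (auto simp: F' toggle_entry_def)
  show "columns_distinct a F'"
    unfolding columns_distinct_def
  proof (intro allI impI)
    fix r1 r2 c' assume *: "(r1, c') \<in> diagram a \<and> (r2, c') \<in> diagram a \<and> r1 \<noteq> r2"
    have "False" if "x \<in> F' r1 c'" "x \<in> F' r2 c'" for x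
      using that * toggle_entry_unique SSF_D(9)[OF F, of x _ c'] unfolding toggle_entry_mem
      by (auto split: if_splits)
    then show "F' r1 c' \<inter> F' r2 c' = {}" by blast
  qed
  show "anchor F r' (Suc c') \<le> x"
    if "(r', c') \<in> diagram a" "(r', Suc c') \<in> diagram a" "x \<in> F' r' c'" for r' c' x
    using SSF_D(6)[OF F that(1,2)] that r(1) unfolding toggle_entry_mem
    by (auto simp: free_entry_fits_def split: if_splits)
  show "triple_condition a F'"
    using F unfolding SSF_iff triple_condition_def toggle_entry_anchor by blast
  show "free_entries_minimal a F'"
    unfolding free_entries_minimal_def toggle_entry_anchor toggle_entry_fits
  proof clarify
    fix r1 c1 x r2
    assume *: "(r1, c1) \<in> diagram a" "x \<in> F' r1 c1" "x \<noteq> anchor F r1 c1" "free_entry_fits a F x r2 c1"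
    show "anchor F r1 c1 \<le> anchor F r2 c1"
    proof (cases "x \<in> F r1 c1")
      case True
      then show ?thesis
        using F * unfolding SSF_iff free_entries_minimal_def by blast
    next
      case False
      then have "r1 = r" "c1 = c" "x = e" using *(2) by (auto simp: toggle_entry_mem split: if_splits)
      then show ?thesis using r(2) * by simp
    qed
  qed
  show "anchor F r' 1 = r'" if "(r', 1) \<in> diagram a" for r'
    using SSF_D(7)[OF F that] .
qed

lemma toggle_entry_twice: "toggle_entry F' r c e = F"
  by (auto simp: F' toggle_entry_def fun_eq_iff)

end

definition filling_sign :: "wcomp \<Rightarrow> filling \<Rightarrow> int" where
  "filling_sign a F = (-1) ^ filling_excess a F"

text \<open>A product over boxes isolates the effect of changing a single box. Every box has an
  entry, so the subtraction in the excess is exact.\<close>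

lemma filling_sign:
  assumes F: "F \<in> SSF a"
  shows "filling_sign a F = (-1) ^ wsize a * (\<Prod>(r, c)\<in>diagram a. (-1) ^ card (F r c))"
proof -
  let ?N = "\<Sum>(r, c)\<in>diagram a. card (F r c)"
  have "(\<Sum>p\<in>diagram a. 1) \<le> ?N"
    using SSF_D(1,2)[OF F] by (intro sum_mono) (auto simp: Suc_le_eq card_gt_0_iff)
  then have "wsize a \<le> ?N" by (simp add: card_diagram)
  then have "(-1 :: int) ^ wsize a * (-1) ^ (?N - wsize a) = (-1) ^ ?N"
    by (simp add: power_add[symmetric])
  then have "(-1 :: int) ^ (?N - wsize a) = (-1) ^ wsize a * (-1) ^ ?N"
    by (metis (no_types) left_minus_one_mult_self)
  also have "(-1 :: int) ^ ?N = (\<Prod>p\<in>diagram a. (-1) ^ (case p of (r, c) \<Rightarrow> card (F r c)))"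
    by (rule power_sum)
  finally show ?thesis
    by (simp add: filling_sign_def filling_excess_def case_prod_beta)
qed

lemma toggle_entry_sign:
  assumes F: "F \<in> SSF a" "toggle_entry F r c e \<in> SSF a" and d: "(r, c) \<in> diagram a"
  shows "filling_sign a (toggle_entry F r c e) = - filling_sign a F"
proof -
  let ?F' = "toggle_entry F r c e"
  let ?s = "\<lambda>F (r, c). (-1 :: int) ^ card (F r c :: nat set)"
  have fin: "finite (F r c)" using SSF_D(2)[OF F(1)] .
  have "?s ?F' (r, c) = - ?s F (r, c)"
  proof (cases "e \<in> F r c")
    case True
    then have "card (F r c) = Suc (card (F r c - {e}))" using fin by (intro card.remove)
    then show ?thesis using True by (simp add: toggle_entry_def del: card_Diff_insert)
  qed (use fin in \<open>simp add: toggle_entry_def\<close>)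
  moreover have "prod (?s ?F') (diagram a - {(r, c)}) = prod (?s F) (diagram a - {(r, c)})"
  proof (intro prod.cong refl)
    fix p assume "p \<in> diagram a - {(r, c)}"
    moreover obtain r' c' where "p = (r', c')" by (cases p)
    moreover have "?F' r' c' = F r' c'" if "(r', c') \<noteq> (r, c)"
      using that by (auto simp: toggle_entry_def)
    ultimately show "?s ?F' p = ?s F p" by simp
  qed
  ultimately show ?thesis
    unfolding filling_sign[OF F(1)] filling_sign[OF F(2)]
    using prod.remove[OF finite_diagram d, of "?s F"] prod.remove[OF finite_diagram d, of "?s ?F'"]
    by simp
qed

lemma toggle_available:
  assumes F: "F \<in> SSF a" and T: "0 \<notin> T" "\<And>r c. F r c \<subseteq> T" and av: "available a T F \<noteq> {}"
  defines "F' \<equiv> toggle_available a T F"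
  shows "F' \<in> SSF a" "F' r c \<subseteq> T" "available a T F' = available a T F" "toggle_available a T F' = F"
    "filling_sign a F' = - filling_sign a F"
proof -
  obtain c e where ce: "(SOME x. x \<in> available a T F) = (c, e)" by (meson surj_pair)
  then have "(c, e) \<in> available a T F" using av by (metis some_in_eq)
  then obtain r0 where e: "e \<in> T" "\<And>r. (r, c) \<in> diagram a \<Longrightarrow> anchor F r c \<noteq> e"
    and r0: "free_entry_fits a F e r0 c"
    by (auto simp: available_def)
  define r where "r = lowest_fit a F c e"
  note r = lowest_fit[OF r0, folded r_def]
  have F': "F' = toggle_entry F r c e"
    by (simp add: F'_def toggle_available_def ce r_def)
  have e0: "e \<noteq> 0" using e(1) T(1) by metis
  note t = F e0 e(2) r F'
  note anchor = toggle_entry_anchor[OF t]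
  note fits = toggle_entry_fits[OF t]
  show SSF: "F' \<in> SSF a" by (rule toggle_entry_SSF[OF t])
  show av': "available a T F' = available a T F"
    by (simp add: available_def anchor fits)
  have "lowest_fit a F' c e = r"
    by (simp add: r_def lowest_fit_def anchor fits)
  then show "toggle_available a T F' = F"
    using toggle_entry_twice[OF t] by (simp add: toggle_available_def av' ce)
  show "filling_sign a F' = - filling_sign a F"
    using toggle_entry_sign F SSF toggle_entry_box(1)[OF t] unfolding F' by blast
  show "F' r c \<subseteq> T" for r c
    using T(2)[of r c] e(1) by (auto simp: toggle_entry_mem[OF t] split: if_splits)
qed

section \<open>Fillings without available entries\<close>

definition constant_filling :: "wcomp \<Rightarrow> filling" where
  "constant_filling a r c = (if (r, c) \<in> diagram a then {r} else {})"

text \<open>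
  If some anchor of column \<open>c\<close> exceeds the missing value \<open>e\<close>, then, as \<open>e\<close> does not fit into that box,
  so does the anchor to its right; by the row condition \<open>e\<close> is missing from column \<open>c + 1\<close> as well, and
  the row would never end.
\<close>

lemma saturated_below:
  assumes F: "F \<in> SSF a" and av: "available a T F = {}" and "e \<in> T" and d: "(r, c) \<in> diagram a"
    and e: "\<And>r'. (r', c) \<in> diagram a \<Longrightarrow> anchor F r' c \<noteq> e"
  shows "anchor F r c < e"
proof (rule ccontr)
  assume "\<not> anchor F r c < e"
  with e[OF d] have "e < anchor F r c" by simp
  then show False using d e
  proof (induction "entry a r - c" arbitrary: c rule: less_induct)
    case less
    have right: "(r', Suc c) \<in> diagram a \<and> e < anchor F r' (Suc c)"
      if "(r', c) \<in> diagram a" "e < anchor F r' c" for r'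
    proof -
      have "\<not> free_entry_fits a F e r' c"
        using av \<open>e \<in> T\<close> less.prems(3) by (auto simp: available_def)
      then show ?thesis using that by (auto simp: free_entry_fits_def)
    qed
    have "anchor F r' (Suc c) \<noteq> e" if d': "(r', Suc c) \<in> diagram a" for r'
    proof
      assume eq: "anchor F r' (Suc c) = e"
      have d: "(r', c) \<in> diagram a" using d' less.prems(2) by (simp add: mem_diagram)
      have "e \<le> anchor F r' c" using SSF_D(6)[OF F d d' SSF_D(5)[OF F d]] eq by simp
      then have "e < anchor F r' c" using less.prems(3)[OF d] by simp
      then show False using right[OF d] eq by simp
    qed
    moreover have "(r, Suc c) \<in> diagram a \<and> e < anchor F r (Suc c)"
      using right less.prems by blast
    moreover from this have "entry a r - Suc c < entry a r - c"
      by (intro diff_less_mono2) (auto simp: mem_diagram)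
    ultimately show False using less.hyps[of "Suc c"] by blast
  qed
qed

text \<open>By induction along the columns, \<open>saturated_below\<close> and the triple condition
  force every anchor to be its row index; any free entry would then be available.\<close>

lemma saturated_filling:
  assumes F: "F \<in> SSF a" and FT: "\<And>r c. F r c \<subseteq> T" and av: "available a T F = {}"
    and T: "Poly_Mapping.keys a \<subseteq> T" "T \<subseteq> initial_interval (Poly_Mapping.keys a)"
  shows "T = Poly_Mapping.keys a" "sorted_wrt (\<ge>) (flat a)" "F = constant_filling a"
proof -
  note sat = saturated_below[OF F av]
  show TK: "T = Poly_Mapping.keys a"
  proof (rule ccontr)
    assume "T \<noteq> Poly_Mapping.keys a"
    then obtain t where t: "t \<in> T" "t \<notin> Poly_Mapping.keys a" using T by auto
    then obtain s where s: "s \<in> Poly_Mapping.keys a" "t \<le> s" using T by (auto simp: initial_interval_def)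
    have d: "(s, 1) \<in> diagram a" using s by (auto simp: mem_diagram in_keys_iff)
    \<comment> \<open>The anchors of the first column are exactly the elements of the support of
      \<open>a\<close>, so \<open>t\<close> is missing there, although row \<open>s\<close> has the
      larger anchor \<open>s\<close>.\<close>
    have "anchor F r 1 \<noteq> t" if "(r, 1) \<in> diagram a" for r
      using SSF_D(7)[OF F that] that t by (auto simp: mem_diagram in_keys_iff)
    then have "anchor F s 1 < t" using sat[OF t(1) d] by blast
    then show False using SSF_D(7)[OF F d] s by simp
  qed
  \<comment> \<open>The second conjunct, that the rows reaching column \<open>c\<close> are closed
    downwards in the support, makes the induction work and later yields sortedness.\<close>
  have anchors: "(\<forall>r. (r, c) \<in> diagram a \<longrightarrow> anchor F r c = r) \<and>
      (\<forall>r\<in>Poly_Mapping.keys a. \<forall>r'. (r', c) \<in> diagram a \<and> r < r' \<longrightarrow> (r, c) \<in> diagram a)"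
    if "1 \<le> c" for c
    using that
  proof (induction c rule: dec_induct)
    case base
    then show ?case using SSF_D(7)[OF F] by (auto simp: mem_diagram in_keys_iff Suc_le_eq)
  next
    case (step c)
    let ?R = "{r. (r, Suc c) \<in> diagram a}"
    let ?f = "\<lambda>r. anchor F r (Suc c)"
    have pred: "(r, c) \<in> diagram a" if "(r, Suc c) \<in> diagram a" for r
      using that step.hyps by (simp add: mem_diagram)
    have le: "?f r \<le> r" if "r \<in> ?R" for r
      using SSF_anchor_le[OF F] that by simp
    \<comment> \<open>If row \<open>?f r\<close> ended at column \<open>c\<close>, it would be
      shorter than row \<open>r\<close> and lie below it. Its anchor in column \<open>c\<close>
      would equal the anchor of row \<open>r\<close> in the next column, violating the triple
      condition.\<close>
    have closed: "?f r \<in> ?R" if "r \<in> ?R" for r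
    proof (rule ccontr)
      assume nR: "?f r \<notin> ?R"
      have d: "(r, Suc c) \<in> diagram a" "(r, c) \<in> diagram a" using that pred by auto
      have lt: "?f r < r" using le[OF that] nR that by (cases "?f r = r") auto
      have "?f r \<in> Poly_Mapping.keys a" using SSF_D(5)[OF F d(1)] FT TK by blast
      then have d': "(?f r, c) \<in> diagram a" using step.IH d lt by blast
      have "entry a (?f r) < entry a r" using nR d d' by (auto simp: mem_diagram)
      moreover have "anchor F (?f r) c = ?f r" "anchor F r c = r" using step.IH d d' by auto
      moreover have "triple_condition a F" using F by (simp add: SSF_iff)
      ultimately show False
        using d d' lt unfolding triple_condition_def by (metis less_not_sym less_irrefl)
    qed
    have "inj_on ?f ?R"
      using SSF_D(5,9)[OF F] by (intro inj_onI) (metis mem_Collect_eq)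
    then have id: "?f r = r" if "r \<in> ?R" for r
      using inj_le_imp_id[of ?f ?R r] closed le that by blast
    moreover have "r \<in> ?R" if r: "r \<in> Poly_Mapping.keys a" and r': "r' \<in> ?R" "r < r'" for r r'
    proof (rule ccontr)
      assume "r \<notin> ?R"
      \<comment> \<open>A row \<open>r\<close> ending too early leaves the value \<open>r\<close>
        missing among the anchors, so \<open>saturated_below\<close> bounds the anchor of the higher
        row \<open>r'\<close> by \<open>r\<close>.\<close>
      then have "?f q \<noteq> r" if "(q, Suc c) \<in> diagram a" for q using id that by auto
      then have "?f r' < r" using sat[of r r' "Suc c"] r r' TK by simp
      then show False using id[OF r'(1)] r' by simp
    qed
    ultimately show ?case by blast
  qed
  show "sorted_wrt (\<ge>) (flat a)"
    unfolding sorted_flat_iff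
  proof (intro ballI impI)
    fix r r' assume "r \<in> Poly_Mapping.keys a" "r' \<in> Poly_Mapping.keys a" "r < r'"
    moreover from this have "1 \<le> entry a r'" by (simp add: in_keys_iff)
    moreover have "(r', entry a r') \<in> diagram a" using \<open>1 \<le> entry a r'\<close> by (simp add: mem_diagram)
    ultimately have "(r, entry a r') \<in> diagram a" using anchors by blast
    then show "entry a r' \<le> entry a r" by (simp add: mem_diagram)
  qed
  show "F = constant_filling a"
  proof (intro ext)
    fix r c
    show "F r c = constant_filling a r c"
    proof (cases "(r, c) \<in> diagram a")
      case True
      then have an: "anchor F r c = r" using anchors by (simp add: mem_diagram)
      \<comment> \<open>Another entry would be free and, by (S.1), different from all anchors of its
        column, hence available.\<close>
      have "x = r" if x: "x \<in> F r c" for x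
      proof (rule ccontr)
        assume "x \<noteq> r"
        then have "free_entry_fits a F x r c" using free_entry_fits_self[OF F x] an by simp
        moreover have "anchor F r' c \<noteq> x" if "(r', c) \<in> diagram a" for r'
          using SSF_D(9)[OF F x, of r'] SSF_D(5)[OF F that] an \<open>x \<noteq> r\<close> by auto
        ultimately have "(c, x) \<in> available a T F" using x FT by (auto simp: available_def)
        then show False using av by simp
      qed
      then show ?thesis using True SSF_D(1)[OF F True] by (auto simp: constant_filling_def)
    qed (use SSF_D(4)[OF F] in \<open>simp add: constant_filling_def\<close>)
  qed
qed

text \<open>Sortedness enters through saturation: a row \<open>e\<close> of the support below row
  \<open>r\<close> is at least as long, so \<open>e\<close> is already an anchor in every column
  that row \<open>r\<close> reaches.\<close>

lemma constant_filling:
  assumes a: "a \<in> weak_compositions n" and s: "sorted_wrt (\<ge>) (flat a)"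
  defines "F \<equiv> constant_filling a"
  shows "F \<in> SSF a" "F r c \<subseteq> Poly_Mapping.keys a" "available a (Poly_Mapping.keys a) F = {}"
    "filling_sign a F = 1"
proof -
  have F: "F r c = {r}" if "(r, c) \<in> diagram a" for r c
    using that by (simp add: F_def constant_filling_def)
  have F0: "F r c = {}" if "(r, c) \<notin> diagram a" for r c
    using that by (simp add: F_def constant_filling_def)
  have pos: "r \<noteq> 0" if "(r, c) \<in> diagram a" for r c
    using that weak_compositions_keys[OF a, of r] by (auto simp: mem_diagram in_keys_iff)
  show "F \<in> SSF a"
    unfolding SSF_iff
    by (auto simp: F F0 columns_distinct_def triple_condition_def free_entries_minimal_def dest: pos)
  show "F r c \<subseteq> Poly_Mapping.keys a" for r c
    by (auto simp: F_def constant_filling_def mem_diagram in_keys_iff)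
  show "available a (Poly_Mapping.keys a) F = {}"
  proof -
    have False if e: "e \<in> Poly_Mapping.keys a" "\<And>r. (r, c) \<in> diagram a \<Longrightarrow> r \<noteq> e"
      and r: "(r, c) \<in> diagram a" "e < r" for c e r
    proof -
      have "r \<in> Poly_Mapping.keys a" using r(1) by (auto simp: mem_diagram in_keys_iff)
      then have "entry a r \<le> entry a e" using s e(1) r(2) by (simp add: sorted_flat_iff)
      then have "(e, c) \<in> diagram a" using r(1) by (auto simp: mem_diagram)
      then show False using e(2) by blast
    qed
    then show ?thesis by (fastforce simp: available_def free_entry_fits_def F)
  qed
  have "(\<Sum>(r, c)\<in>diagram a. card (F r c)) = (\<Sum>p\<in>diagram a. 1)"
    by (intro sum.cong) (auto simp: F)
  then show "filling_sign a F = 1"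
    by (simp add: filling_sign_def filling_excess_def card_diagram)
qed

definition filling_count :: "wcomp \<Rightarrow> nat set \<Rightarrow> int" where
  "filling_count a T = (\<Sum>F | F \<in> SSF a \<and> (\<forall>r c. F r c \<subseteq> T). filling_sign a F)"

text \<open>Fillings with an available pair cancel under toggling; at most the constant filling
  remains.\<close>

lemma filling_count:
  assumes a: "a \<in> weak_compositions n"
    and T: "Poly_Mapping.keys a \<subseteq> T" "T \<subseteq> initial_interval (Poly_Mapping.keys a)"
  shows "filling_count a T = (if T = Poly_Mapping.keys a \<and> sorted_wrt (\<ge>) (flat a) then 1 else 0)"
proof -
  let ?X = "{F. F \<in> SSF a \<and> (\<forall>r c. F r c \<subseteq> T)}"
  let ?U = "{F \<in> ?X. available a T F \<noteq> {}}" and ?S = "{F \<in> ?X. available a T F = {}}"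
  have T0: "0 \<notin> T" using T(2) by (auto simp: initial_interval_def)
  have "finite ?X" using finite_SSF by simp
  then have "filling_count a T = sum (filling_sign a) (?U \<union> ?S)"
    unfolding filling_count_def by (intro sum.cong) auto
  also have "\<dots> = sum (filling_sign a) ?U + sum (filling_sign a) ?S"
  proof (rule sum.union_disjoint)
    show "finite ?U" "finite ?S" by (rule finite_subset[OF _ \<open>finite ?X\<close>]; blast)+
  qed blast
  also have "sum (filling_sign a) ?U = 0"
  proof (rule sum_eq_0_if_sign_reversing[where h = "toggle_available a T"])
    fix F assume "F \<in> ?U"
    then have F: "F \<in> SSF a" "\<And>r c. F r c \<subseteq> T" "available a T F \<noteq> {}" by auto
    note t = toggle_available[OF F(1) T0 F(2,3)]
    show "toggle_available a T F \<in> ?U" using t(1,2,3) F(3) by simp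
    show "toggle_available a T (toggle_available a T F) = F" by (rule t(4))
    show "filling_sign a (toggle_available a T F) = - filling_sign a F" by (rule t(5))
  qed
  also have "?S = (if T = Poly_Mapping.keys a \<and> sorted_wrt (\<ge>) (flat a) then {constant_filling a} else {})"
  proof (cases "T = Poly_Mapping.keys a \<and> sorted_wrt (\<ge>) (flat a)")
    case True
    then have "constant_filling a \<in> ?S" using constant_filling[OF a] by simp
    moreover have "F = constant_filling a" if "F \<in> ?S" for F
      using that by (intro saturated_filling(3)[OF _ _ _ T]) simp_all
    ultimately show ?thesis unfolding if_P[OF True] by blast
  next
    case False
    have "F \<notin> ?S" for F
    proof
      assume "F \<in> ?S"
      then have F: "F \<in> SSF a" "\<And>r c. F r c \<subseteq> T" "available a T F = {}" by auto
      show False using saturated_filling(1,2)[OF F T] False by blast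
    qed
    then show ?thesis unfolding if_not_P[OF False] by blast
  qed
  finally show ?thesis
    using constant_filling(4)[OF a] by (cases "T = Poly_Mapping.keys a \<and> sorted_wrt (\<ge>) (flat a)") simp_all
qed


section \<open>Values on kaons and Lascoux atoms\<close>

text \<open>The value of the monomial \<open>b\<close> when the variables indexed by
  \<open>T\<close> are 1 and the others 0.\<close>

definition supported_in :: "nat set \<Rightarrow> wcomp \<Rightarrow> int" where
  "supported_in T b = (if Poly_Mapping.keys b \<subseteq> T then 1 else 0)"

definition completions :: "wcomp \<Rightarrow> int" where
  "completions b = int (card {T. Poly_Mapping.keys b \<subseteq> T \<and> T \<subseteq> initial_interval (Poly_Mapping.keys b)})"

context
  fixes K :: "nat set" and f :: xpoly and v :: int
  assumes K: "finite K" "K \<subseteq> initial_interval K"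
    and keys: "\<And>b. b \<in> Poly_Mapping.keys f \<Longrightarrow> K \<subseteq> Poly_Mapping.keys b \<and> Poly_Mapping.keys b \<subseteq> initial_interval K"
    and val: "\<And>T. K \<subseteq> T \<Longrightarrow> T \<subseteq> initial_interval K \<Longrightarrow> beta_eval (supported_in T) f = (if T = K then v else 0)"
begin

text \<open>
  All monomials of \<open>f\<close> have the same \<^const>\<open>initial_interval\<close>, so \<^const>\<open>completions\<close> is, on these, the
  sum of the functionals \<^term>\<open>supported_in T\<close>.
\<close>

lemma beta_eval_completions: "beta_eval completions f = v"
proof -
  let ?I = "initial_interval K"
  let ?P = "{T. K \<subseteq> T \<and> T \<subseteq> ?I}"
  have fin: "finite ?P" using finite_initial_interval[OF K(1)] by (auto intro: finite_subset[of _ "Pow ?I"])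
  have g: "completions b = (\<Sum>T\<in>?P. supported_in T b)" if "b \<in> Poly_Mapping.keys f" for b
  proof -
    have b: "K \<subseteq> Poly_Mapping.keys b" "initial_interval (Poly_Mapping.keys b) = ?I"
      using keys[OF that] initial_interval_eqI by auto
    have "(\<Sum>T\<in>?P. supported_in T b) = int (card {T \<in> ?P. Poly_Mapping.keys b \<subseteq> T})"
      using fin by (simp add: supported_in_def sum.If_cases Int_def)
    also have "{T \<in> ?P. Poly_Mapping.keys b \<subseteq> T} = {T. Poly_Mapping.keys b \<subseteq> T \<and> T \<subseteq> ?I}"
      using b(1) by blast
    finally show ?thesis by (simp add: completions_def b(2))
  qed
  have "beta_eval completions f = (\<Sum>b\<in>Poly_Mapping.keys f. \<Sum>T\<in>?P. poly (entry f b) (-1) * supported_in T b)"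
    unfolding beta_eval_def by (intro sum.cong refl) (simp only: g sum_distrib_left)
  also have "\<dots> = (\<Sum>T\<in>?P. beta_eval (supported_in T) f)"
    unfolding beta_eval_def by (rule sum.swap)
  also have "\<dots> = (\<Sum>T\<in>?P. if T = K then v else 0)"
    by (intro sum.cong refl val) blast+
  also have "\<dots> = v" using fin K(2) by simp
  finally show ?thesis .
qed

text \<open>For \<open>T\<close> the whole initial interval, \<open>supported_in T\<close> is 1 on
  every monomial of \<open>f\<close>.\<close>

lemma beta_eval_one: "beta_eval (\<lambda>_. 1) f = (if K = initial_interval K then v else 0)"
proof -
  have "beta_eval (\<lambda>_. 1) f = beta_eval (supported_in (initial_interval K)) f"
    unfolding beta_eval_def by (intro sum.cong) (simp_all add: supported_in_def keys)
  then show ?thesis using val[of "initial_interval K"] K by auto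
qed

end

lemma keys_beta_monomial: "Poly_Mapping.keys (beta_monomial k b) = {b}"
  by (simp add: beta_monomial_def)

lemma keys_kaon:
  assumes "b \<in> Poly_Mapping.keys (kaon n a)"
  shows "b \<in> weak_compositions n" "Poly_Mapping.keys a \<subseteq> Poly_Mapping.keys b"
    "Poly_Mapping.keys b \<subseteq> initial_interval (Poly_Mapping.keys a)"
proof -
  have "b \<in> (\<Union>x\<in>{(b, R). mesonic_glide n a (b, R)}. Poly_Mapping.keys (case x of (b, R) \<Rightarrow> beta_monomial (card R) b))"
    by (rule subsetD[OF keys_sum assms[unfolded kaon_def]])
  then obtain R where m: "mesonic_glide n a (b, R)" by (auto simp: keys_beta_monomial)
  show "b \<in> weak_compositions n" "Poly_Mapping.keys a \<subseteq> Poly_Mapping.keys b"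
    "Poly_Mapping.keys b \<subseteq> initial_interval (Poly_Mapping.keys a)"
    using mesonic_glide_keys[OF m] by auto
qed

lemma beta_eval_supported_in_kaon: "beta_eval (supported_in T) (kaon n a) = glide_count n a T"
proof -
  have "beta_eval (supported_in T) (kaon n a) = (\<Sum>(b, R) | mesonic_glide n a (b, R). (-1) ^ card R * supported_in T b)"
    unfolding kaon_def beta_eval_sum by (intro sum.cong) (auto simp: beta_eval_beta_monomial)
  also have "\<dots> = glide_count n a T"
    unfolding glide_count_def
    by (intro sum.mono_neutral_cong_right finite_mesonic_glides)
      (auto simp: supported_in_def split: if_splits)
  finally show ?thesis .
qed

lemma
  assumes a: "a \<in> weak_compositions n"
  shows beta_eval_completions_kaon: "beta_eval completions (kaon n a) = 1"
    and beta_eval_one_kaon: "beta_eval (\<lambda>_. 1) (kaon n a) =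
      (if Poly_Mapping.keys a = initial_interval (Poly_Mapping.keys a) then 1 else 0)"
proof -
  note * = finite_keys keys_subset_initial_interval[OF a]
  have k: "Poly_Mapping.keys a \<subseteq> Poly_Mapping.keys b \<and> Poly_Mapping.keys b \<subseteq> initial_interval (Poly_Mapping.keys a)"
    if "b \<in> Poly_Mapping.keys (kaon n a)" for b
    using keys_kaon[OF that] by simp
  have v: "beta_eval (supported_in T) (kaon n a) = (if T = Poly_Mapping.keys a then 1 else 0)"
    if "Poly_Mapping.keys a \<subseteq> T" "T \<subseteq> initial_interval (Poly_Mapping.keys a)" for T
    by (simp add: beta_eval_supported_in_kaon glide_count[OF a that])
  show "beta_eval completions (kaon n a) = 1" by (rule beta_eval_completions[OF * k v])
  show "beta_eval (\<lambda>_. 1) (kaon n a) =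
      (if Poly_Mapping.keys a = initial_interval (Poly_Mapping.keys a) then 1 else 0)"
    by (rule beta_eval_one[OF * k v])
qed

text \<open>Multiplicities are natural numbers, so nothing cancels: an exponent vanishes only if its
  index occurs in no box.\<close>

lemma keys_filling_weight:
  assumes F: "F \<in> SSF a"
  shows "Poly_Mapping.keys (filling_weight a F) = (\<Union>r. \<Union>c. F r c)"
proof -
  have *: "(if e = i then 1 else 0) = (0 :: nat) \<longleftrightarrow> e \<noteq> i" for e i :: nat
    by simp
  have "entry (filling_weight a F) i = (\<Sum>p\<in>diagram a. \<Sum>e\<in>F (fst p) (snd p). if e = i then 1 else 0)" for i
    unfolding filling_weight_def lookup_sum case_prod_beta lookup_single when_def ..
  then have "i \<in> Poly_Mapping.keys (filling_weight a F) \<longleftrightarrow> (\<exists>p\<in>diagram a. i \<in> F (fst p) (snd p))" for i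
    by (simp only: in_keys_iff sum_eq_0_iff finite_diagram SSF_D(2)[OF F] *) blast
  moreover have "(\<exists>p\<in>diagram a. i \<in> F (fst p) (snd p)) \<longleftrightarrow> (\<exists>r c. i \<in> F r c)" for i
    using SSF_D(10)[OF F] by (metis fst_conv snd_conv)
  ultimately show ?thesis by (intro set_eqI) (simp only: UN_iff UNIV_I bex_UNIV)
qed

lemma filling_weight_bounds:
  assumes F: "F \<in> SSF a"
  shows "Poly_Mapping.keys a \<subseteq> Poly_Mapping.keys (filling_weight a F)"
    "Poly_Mapping.keys (filling_weight a F) \<subseteq> initial_interval (Poly_Mapping.keys a)"
proof -
  show "Poly_Mapping.keys a \<subseteq> Poly_Mapping.keys (filling_weight a F)"
  proof
    fix r assume "r \<in> Poly_Mapping.keys a"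
    then have d: "(r, 1) \<in> diagram a" by (auto simp: mem_diagram in_keys_iff)
    show "r \<in> Poly_Mapping.keys (filling_weight a F)"
      using SSF_D(5)[OF F d] SSF_D(7)[OF F d] unfolding keys_filling_weight[OF F] by auto
  qed
  show "Poly_Mapping.keys (filling_weight a F) \<subseteq> initial_interval (Poly_Mapping.keys a)"
    using SSF_entries[OF F] unfolding keys_filling_weight[OF F] by blast
qed

lemma keys_lascoux_atom:
  assumes "b \<in> Poly_Mapping.keys (lascoux_atom a)"
  shows "Poly_Mapping.keys a \<subseteq> Poly_Mapping.keys b"
    "Poly_Mapping.keys b \<subseteq> initial_interval (Poly_Mapping.keys a)"
proof -
  have "b \<in> (\<Union>F\<in>SSF a. Poly_Mapping.keys (beta_monomial (filling_excess a F) (filling_weight a F)))"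
    by (rule subsetD[OF keys_sum assms[unfolded lascoux_atom_def]])
  then obtain F where F: "F \<in> SSF a" "b = filling_weight a F" by (auto simp: keys_beta_monomial)
  show "Poly_Mapping.keys a \<subseteq> Poly_Mapping.keys b"
    "Poly_Mapping.keys b \<subseteq> initial_interval (Poly_Mapping.keys a)"
    unfolding F(2) by (rule filling_weight_bounds[OF F(1)])+
qed

lemma keys_lascoux_atom_subset:
  assumes "a \<in> weak_compositions n"
  shows "Poly_Mapping.keys (lascoux_atom a) \<subseteq> weak_compositions n"
proof
  fix b assume "b \<in> Poly_Mapping.keys (lascoux_atom a)"
  from order_trans[OF keys_lascoux_atom(2)[OF this] initial_interval_subset[OF assms]]
  have "Poly_Mapping.keys b \<subseteq> {1..n}" .
  then show "b \<in> weak_compositions n" by (simp add: weak_compositions_def)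
qed

lemma beta_eval_supported_in_lascoux_atom: "beta_eval (supported_in T) (lascoux_atom a) = filling_count a T"
proof -
  have "beta_eval (supported_in T) (lascoux_atom a) =
      (\<Sum>F\<in>SSF a. filling_sign a F * supported_in T (filling_weight a F))"
    unfolding lascoux_atom_def beta_eval_sum by (simp add: beta_eval_beta_monomial filling_sign_def)
  also have "\<dots> = (\<Sum>F | F \<in> SSF a \<and> (\<forall>r c. F r c \<subseteq> T). filling_sign a F)"
  proof (intro sum.mono_neutral_cong_right finite_SSF ballI)
    fix F assume "F \<in> {F \<in> SSF a. \<forall>r c. F r c \<subseteq> T}"
    then show "filling_sign a F * supported_in T (filling_weight a F) = filling_sign a F"
      using keys_filling_weight[of F a] by (auto simp: supported_in_def)
  next
    fix F assume F: "F \<in> SSF a - {F \<in> SSF a. \<forall>r c. F r c \<subseteq> T}"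
    then have "\<not> Poly_Mapping.keys (filling_weight a F) \<subseteq> T"
      using keys_filling_weight[of F a] by auto
    then show "filling_sign a F * supported_in T (filling_weight a F) = 0"
      by (simp add: supported_in_def)
  qed auto
  finally show ?thesis by (simp add: filling_count_def)
qed

lemma
  assumes a: "a \<in> weak_compositions n"
  shows beta_eval_completions_lascoux_atom: "beta_eval completions (lascoux_atom a) =
      (if sorted_wrt (\<ge>) (flat a) then 1 else 0)"
    and beta_eval_one_lascoux_atom: "beta_eval (\<lambda>_. 1) (lascoux_atom a) =
      (if Poly_Mapping.keys a = initial_interval (Poly_Mapping.keys a)
       then if sorted_wrt (\<ge>) (flat a) then 1 else 0 else 0)"
proof -
  note * = finite_keys keys_subset_initial_interval[OF a]
  have k: "Poly_Mapping.keys a \<subseteq> Poly_Mapping.keys b \<and> Poly_Mapping.keys b \<subseteq> initial_interval (Poly_Mapping.keys a)"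
    if "b \<in> Poly_Mapping.keys (lascoux_atom a)" for b
    using keys_lascoux_atom[OF that] by simp
  have v: "beta_eval (supported_in T) (lascoux_atom a) =
      (if T = Poly_Mapping.keys a then if sorted_wrt (\<ge>) (flat a) then 1 else 0 else 0)"
    if "Poly_Mapping.keys a \<subseteq> T" "T \<subseteq> initial_interval (Poly_Mapping.keys a)" for T
    by (simp add: beta_eval_supported_in_lascoux_atom filling_count[OF a that])
  show "beta_eval completions (lascoux_atom a) = (if sorted_wrt (\<ge>) (flat a) then 1 else 0)"
    by (rule beta_eval_completions[OF * k v])
  show "beta_eval (\<lambda>_. 1) (lascoux_atom a) =
      (if Poly_Mapping.keys a = initial_interval (Poly_Mapping.keys a)
       then if sorted_wrt (\<ge>) (flat a) then 1 else 0 else 0)"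
    by (rule beta_eval_one[OF * k v])
qed


section \<open>Glide and quasiLascoux polynomials\<close>

definition flat_above :: "nat \<Rightarrow> wcomp \<Rightarrow> wcomp set" where
  "flat_above n a = {b. b \<in> weak_compositions n \<and> dominates n b a \<and> flat b = flat a}"

lemma length_flat: "length (flat a) = card (Poly_Mapping.keys a)"
  by (simp add: flat_def)

lemma sum_keys_weak_composition:
  assumes "a \<in> weak_compositions n"
  shows "(\<Sum>k\<in>Poly_Mapping.keys a. entry a k) = (\<Sum>k=1..n. entry a k)"
  using assms by (intro sum.mono_neutral_left) (auto simp: weak_compositions_def in_keys_iff)

lemma sum_list_flat: "sum_list (flat a) = (\<Sum>k\<in>Poly_Mapping.keys a. entry a k)"
  by (simp add: flat_def sum_list_distinct_conv_sum_set)

lemma flat_aboveD: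
  assumes "c \<in> flat_above n a"
  shows "c \<in> weak_compositions n" "dominates n c a" "flat c = flat a"
  using assms by (auto simp: flat_above_def)

lemma finite_flat_above: "finite (flat_above n a)"
proof (rule finite_subset[OF _ finite_weak_compositions_bounded])
  show "flat_above n a \<subseteq> {b \<in> weak_compositions n. \<forall>i. entry b i \<le> sum_list (flat a)}"
  proof clarify
    fix b assume b: "b \<in> flat_above n a"
    have "entry b i \<le> sum_list (flat b)" for i
      by (cases "i \<in> Poly_Mapping.keys b") (auto simp: sum_list_flat in_keys_iff intro: member_le_sum)
    then show "b \<in> weak_compositions n \<and> (\<forall>i. entry b i \<le> sum_list (flat a))"
      using flat_aboveD[OF b] by simp
  qed
qed

lemma flat_above_self: "a \<in> weak_compositions n \<Longrightarrow> a \<in> flat_above n a"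
  by (simp add: flat_above_def dominates_def)

text \<open>In the double sum \<open>f k\<close> occurs \<open>n + 1 - k\<close> times.\<close>

lemma sum_by_parts:
  fixes f :: "nat \<Rightarrow> nat"
  shows "(\<Sum>k=1..n. k * f k) + (\<Sum>i=1..n. \<Sum>k=1..i. f k) = (n + 1) * (\<Sum>k=1..n. f k)"
  by (induction n) (auto simp: algebra_simps)

lemma eq_if_partial_sums_eq:
  assumes "a \<in> weak_compositions n" "c \<in> weak_compositions n"
    and eq: "\<And>i. i \<in> {1..n} \<Longrightarrow> (\<Sum>k=1..i. entry c k) = (\<Sum>k=1..i. entry a k)"
  shows "c = a"
proof (rule poly_mapping_eqI)
  fix i
  show "entry c i = entry a i"
  proof (cases "i \<in> {1..n}")
    case True
    then obtain j where j: "i = Suc j" by (cases i) auto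
    have "(\<Sum>k=1..j. entry c k) = (\<Sum>k=1..j. entry a k)"
      using eq[of j] True j by (cases j) auto
    then show ?thesis using eq[OF True] j by simp
  next
    case False
    then have "i \<notin> Poly_Mapping.keys a" "i \<notin> Poly_Mapping.keys c"
      using assms(1,2) by (auto simp: weak_compositions_def)
    then show ?thesis by (simp add: in_keys_iff)
  qed
qed

text \<open>Some partial sum of \<open>c\<close> exceeds that of \<open>a\<close> while the totals
  agree, so by \<open>sum_by_parts\<close> the weighted sum drops. The support sizes agree because
  the flattened sequences do.\<close>

lemma weight_order_flat_above:
  assumes a: "a \<in> weak_compositions n" and c: "c \<in> flat_above n a" "c \<noteq> a"
  shows "weight_order n c < weight_order n a"
proof -
  note cD = flat_aboveD[OF c(1)]
  let ?P = "\<lambda>a i. \<Sum>k=1..i. entry a k"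
  have "\<exists>i\<in>{1..n}. ?P a i \<noteq> ?P c i"
    using eq_if_partial_sums_eq[OF a cD(1)] c(2) by metis
  then have "\<exists>i\<in>{1..n}. ?P a i < ?P c i"
    using cD(2) by (metis dominates_def le_neq_implies_less)
  then have "(\<Sum>i=1..n. ?P a i) < (\<Sum>i=1..n. ?P c i)"
    using cD(2) by (intro sum_strict_mono_ex1) (auto simp: dominates_def)
  moreover have "?P c n = ?P a n"
    using cD(3) sum_keys_weak_composition a cD(1) sum_list_flat by metis
  ultimately have "(\<Sum>k=1..n. k * entry c k) < (\<Sum>k=1..n. k * entry a k)"
    using sum_by_parts[of "entry a" n] sum_by_parts[of "entry c" n] by simp
  moreover have "card (Poly_Mapping.keys c) = card (Poly_Mapping.keys a)"
    using cD(3) length_flat by metis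
  ultimately show ?thesis by (simp add: weight_order_def less_prod_def)
qed

lemma glide_poly_eq: "glide_poly n a = (\<Sum>b\<in>flat_above n a. kaon n b)"
  by (simp add: glide_poly_def flat_above_def)

lemma quasi_lascoux_eq: "quasi_lascoux n a = (\<Sum>b\<in>flat_above n a. lascoux_atom b)"
  by (simp add: quasi_lascoux_def flat_above_def)

lemma unitriangular_glide_poly: "unitriangular n (glide_poly n)"
  unfolding unitriangular_def
proof (intro ballI conjI allI impI)
  fix a assume a: "a \<in> weak_compositions n"
  have kaon: "entry (kaon n c) c = 1"
    "b \<noteq> c \<Longrightarrow> entry (kaon n c) b \<noteq> 0 \<Longrightarrow> b \<in> weak_compositions n \<and> weight_order n b < weight_order n c"
    if "c \<in> flat_above n a" for b c
    using unitriangular_kaon flat_aboveD(1)[OF that] by (auto simp: unitriangular_def)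
  have le: "weight_order n c \<le> weight_order n a" if "c \<in> flat_above n a" for c
    using weight_order_flat_above[OF a that] by (cases "c = a") auto
  have lk: "entry (glide_poly n a) b = (\<Sum>c\<in>flat_above n a. entry (kaon n c) b)" for b
    by (simp add: glide_poly_eq lookup_sum)
  have "entry (kaon n c) a = (if c = a then 1 else 0)" if c: "c \<in> flat_above n a" for c
  proof (cases "c = a")
    case False
    \<comment> \<open>Monomials of the kaon of \<open>c\<close> have order at most that of
      \<open>c\<close>, which is below the order of \<open>a\<close>, so the monomial
      \<open>a\<close> cannot occur.\<close>
    then have "\<not> weight_order n a < weight_order n c"
      using weight_order_flat_above[OF a c] by simp
    then show ?thesis using kaon(2)[OF c, of a] False by auto
  qed (use kaon(1)[OF c] in simp)
  then have "entry (glide_poly n a) a = (\<Sum>c\<in>flat_above n a. if c = a then 1 else 0)"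
    unfolding lk by (intro sum.cong) auto
  then show "entry (glide_poly n a) a = 1"
    using finite_flat_above flat_above_self[OF a] by simp
  fix b assume b: "b \<noteq> a" "entry (glide_poly n a) b \<noteq> 0"
  then obtain c where c: "c \<in> flat_above n a" "entry (kaon n c) b \<noteq> 0"
    unfolding lk by (metis sum.not_neutral_contains_not_neutral)
  show "b \<in> weak_compositions n"
    using kaon(2)[OF c(1) _ c(2)] flat_aboveD(1)[OF c(1)] by (cases "b = c") auto
  show "weight_order n b < weight_order n a"
    using kaon(2)[OF c(1) _ c(2)] le[OF c(1)] weight_order_flat_above[OF a c(1)] b(1)
    by (cases "b = c") auto
qed

section \<open>Packed compositions and evaluation with all variables equal to 1\<close>

lemma initial_interval_fixed:
  assumes "finite K" "K = initial_interval K"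
  shows "K = {1..card K}"
proof (cases "K = {}")
  case False
  have "K = {1..Max K}"
  proof
    show "K \<subseteq> {1..Max K}" using assms by (auto simp: initial_interval_def)
    have "Max K \<in> K" using assms(1) False by (rule Max_in)
    then have "{1..Max K} \<subseteq> initial_interval K" by (auto simp: initial_interval_def)
    then show "{1..Max K} \<subseteq> K" using assms(2) by simp
  qed
  then show ?thesis by (metis card_atLeastAtMost diff_Suc_1)
qed simp

lemma flat_if_keys_interval:
  assumes "Poly_Mapping.keys c = {1..m}"
  shows "flat c = map (entry c) [1..<Suc m]"
proof -
  have "{1..m} = {1..<Suc m}" by auto
  then show ?thesis unfolding flat_def assms by (simp only: sorted_list_of_set_range)
qed

text \<open>The sequence \<open>flat a\<close> followed by zeros. List indices start at 0 and
  positions at 1, hence \<open>Suc i\<close>.\<close>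

definition pack :: "wcomp \<Rightarrow> wcomp" where
  "pack a = (\<Sum>i<length (flat a). Poly_Mapping.single (Suc i) (flat a ! i))"

lemma lookup_pack: "entry (pack a) k = (if 1 \<le> k \<and> k \<le> length (flat a) then flat a ! (k - 1) else 0)"
proof (cases k)
  case 0
  then show ?thesis by (simp add: pack_def lookup_sum lookup_single)
next
  case (Suc j)
  have "entry (pack a) k = (\<Sum>i<length (flat a). if i = j then flat a ! i else 0)"
    unfolding pack_def lookup_sum by (intro sum.cong) (auto simp: Suc lookup_single when_def)
  then show ?thesis by (simp add: Suc Suc_le_eq)
qed

lemma flat_nth_nonzero: "i < length (flat a) \<Longrightarrow> flat a ! i \<noteq> 0"
proof -
  assume "i < length (flat a)"
  then have "flat a ! i \<in> set (flat a)" by simp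
  then show ?thesis by (auto simp: flat_def in_keys_iff simp del: nth_mem)
qed

lemma keys_pack: "Poly_Mapping.keys (pack a) = {1..length (flat a)}"
  using flat_nth_nonzero by (auto simp: in_keys_iff lookup_pack split: if_splits)

lemma flat_pack: "flat (pack a) = flat a"
  unfolding flat_if_keys_interval[OF keys_pack]
  by (rule nth_equalityI) (auto simp del: upt_Suc simp: lookup_pack)

lemma strictly_sorted_nth_ge:
  assumes "sorted_wrt (<) l" "\<And>x. x \<in> set l \<Longrightarrow> 1 \<le> x" "t < length l"
  shows "Suc t \<le> (l ! t :: nat)"
  using assms(3)
proof (induction t)
  case 0
  then show ?case using assms(2)[of "l ! 0"] by simp
next
  case (Suc t)
  have "l ! t < l ! Suc t" using assms(1) Suc.prems by (simp add: sorted_wrt_nth_less)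
  then show ?case using Suc by simp
qed

text \<open>The nonzero entry of \<open>a\<close> with list index \<open>t\<close> sits at position
  \<open>Suc t\<close> or later, so packing moves it weakly to the left and no partial sum
  decreases.\<close>

lemma dominates_pack:
  assumes a: "a \<in> weak_compositions n"
  shows "dominates n (pack a) a"
  unfolding dominates_def
proof
  fix i
  let ?l = "sorted_list_of_set (Poly_Mapping.keys a)"
  let ?A = "{t. t < length ?l \<and> ?l ! t \<le> i}"
  have len: "length (flat a) = length ?l" by (simp add: flat_def)
  have ge: "Suc t \<le> ?l ! t" if "t < length ?l" for t
    using that by (intro strictly_sorted_nth_ge) (auto dest: weak_compositions_keys[OF a])
  have bij: "bij_betw ((!) ?l) ?A (Poly_Mapping.keys a \<inter> {1..i})"
  proof (rule bij_betwI')
    fix s t assume "s \<in> ?A" "t \<in> ?A"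
    then show "(?l ! s = ?l ! t) = (s = t)" by (simp add: nth_eq_iff_index_eq)
  next
    fix t assume t: "t \<in> ?A"
    then have "?l ! t \<in> set ?l" by (intro nth_mem) simp
    then show "?l ! t \<in> Poly_Mapping.keys a \<inter> {1..i}"
      using t weak_compositions_keys[OF a] by auto
  next
    fix k assume "k \<in> Poly_Mapping.keys a \<inter> {1..i}"
    then have "k \<in> set ?l" "k \<le> i" by auto
    then show "\<exists>t\<in>?A. k = ?l ! t" by (metis (mono_tags, lifting) in_set_conv_nth mem_Collect_eq)
  qed
  have "(\<Sum>k=1..i. entry a k) = (\<Sum>k\<in>Poly_Mapping.keys a \<inter> {1..i}. entry a k)"
    by (intro sum.mono_neutral_right) (auto simp: in_keys_iff)
  also have "\<dots> = (\<Sum>t\<in>?A. entry a (?l ! t))"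
    by (rule sum.reindex_bij_betw[OF bij, symmetric])
  also have "\<dots> = (\<Sum>t\<in>?A. entry (pack a) (Suc t))"
    by (intro sum.cong) (auto simp: lookup_pack len, simp add: flat_def)
  also have "\<dots> \<le> (\<Sum>t\<in>{..<i}. entry (pack a) (Suc t))"
    using ge by (intro sum_mono2) (auto intro: Suc_le_lessD order_trans)
  also have "\<dots> = (\<Sum>k=1..i. entry (pack a) k)"
    by (simp add: sum.atLeast1_atMost_eq)
  finally show "(\<Sum>k=1..i. entry a k) \<le> (\<Sum>k=1..i. entry (pack a) k)" .
qed

text \<open>A composition supported on an interval starting at 1 is determined by its nonzero
  sequence, and this sequence is the same throughout \<open>flat_above n a\<close>.\<close>

lemma flat_above_packed:
  assumes a: "a \<in> weak_compositions n" and c: "c \<in> flat_above n a"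
  shows "Poly_Mapping.keys c = initial_interval (Poly_Mapping.keys c) \<longleftrightarrow> c = pack a"
proof
  assume "Poly_Mapping.keys c = initial_interval (Poly_Mapping.keys c)"
  then have K: "Poly_Mapping.keys c = {1..card (Poly_Mapping.keys c)}"
    by (intro initial_interval_fixed) simp_all
  note f = flat_if_keys_interval[OF K, folded length_flat]
  have fa: "flat c = flat a" using flat_aboveD[OF c] by simp
  show "c = pack a"
  proof (rule poly_mapping_eqI)
    fix k
    show "entry c k = entry (pack a) k"
    proof (cases "k \<in> {1..length (flat a)}")
      case True
      then obtain j where j: "k = Suc j" "j < length (flat a)" by (cases k) auto
      have "flat c ! j = map (entry c) [1..<Suc (length (flat c))] ! j"
        by (rule arg_cong[OF f, of "\<lambda>l. l ! j"])
      then have "flat c ! (k - 1) = entry c k"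
        using j fa by (simp del: upt_Suc)
      then show ?thesis using True fa by (simp add: lookup_pack)
    next
      case False
      then have "k \<notin> Poly_Mapping.keys c" using K fa length_flat by metis
      then show ?thesis using False by (auto simp: lookup_pack in_keys_iff)
    qed
  qed
next
  assume "c = pack a"
  then show "Poly_Mapping.keys c = initial_interval (Poly_Mapping.keys c)"
    by (auto simp: keys_pack initial_interval_def)
qed

lemma pack_flat_above:
  assumes a: "a \<in> weak_compositions n"
  shows "pack a \<in> flat_above n a"
proof -
  have "card (Poly_Mapping.keys a) \<le> card {1..n}"
    using a by (intro card_mono) (auto simp: weak_compositions_def)
  then have "pack a \<in> weak_compositions n"
    by (simp add: weak_compositions_def keys_pack length_flat)
  then show ?thesis using dominates_pack[OF a] flat_pack by (simp add: flat_above_def)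
qed

text \<open>Only kaons whose index has gapless support contribute, and \<open>pack a\<close> is the
  one such index in the sum.\<close>

lemma beta_eval_one_glide_poly:
  assumes a: "a \<in> weak_compositions n"
  shows "beta_eval (\<lambda>_. 1) (glide_poly n a) = 1"
proof -
  have "beta_eval (\<lambda>_. 1) (glide_poly n a) = (\<Sum>c\<in>flat_above n a. if c = pack a then 1 else 0)"
    unfolding glide_poly_eq beta_eval_sum
    by (intro sum.cong refl) (simp only: beta_eval_one_kaon[OF flat_aboveD(1)] flat_above_packed[OF a])
  then show ?thesis using pack_flat_above[OF a] finite_flat_above by simp
qed

text \<open>Again only \<open>pack a\<close> contributes; its sortedness is that of
  \<open>a\<close>, as both have the same nonzero sequence.\<close>

lemma beta_eval_one_quasi_lascoux:
  assumes a: "a \<in> weak_compositions n"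
  shows "beta_eval (\<lambda>_. 1) (quasi_lascoux n a) = (if sorted_wrt (\<ge>) (flat a) then 1 else 0)"
proof -
  have "beta_eval (\<lambda>_. 1) (quasi_lascoux n a) =
      (\<Sum>c\<in>flat_above n a. if c = pack a then if sorted_wrt (\<ge>) (flat a) then 1 else 0 else 0)"
    unfolding quasi_lascoux_eq beta_eval_sum
    by (intro sum.cong refl) (simp only: beta_eval_one_lascoux_atom[OF flat_aboveD(1)] flat_above_packed[OF a] flat_aboveD(3))
  then show ?thesis using pack_flat_above[OF a] finite_flat_above by simp
qed

lemma keys_quasi_lascoux_subset: "Poly_Mapping.keys (quasi_lascoux n a) \<subseteq> weak_compositions n"
proof -
  have "Poly_Mapping.keys (quasi_lascoux n a) \<subseteq> (\<Union>c\<in>flat_above n a. Poly_Mapping.keys (lascoux_atom c))"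
    unfolding quasi_lascoux_eq by (rule keys_sum)
  also have "\<dots> \<subseteq> weak_compositions n"
    using keys_lascoux_atom_subset flat_aboveD(1) by blast
  finally show ?thesis .
qed

theorem theorem1:
  fixes n :: nat and a :: wcomp
  assumes "n \<ge> 1" and "a \<in> weak_compositions n"
  shows "(sorted_wrt (\<ge>) (flat a) \<longrightarrow>
            coeff_sum_at (-1) (Q_coeffs n a) = 1 \<and> coeff_sum_at (-1) (M_coeffs n a) = 1) \<and>
         (\<not> sorted_wrt (\<ge>) (flat a) \<longrightarrow>
            coeff_sum_at (-1) (Q_coeffs n a) = 0 \<and> coeff_sum_at (-1) (M_coeffs n a) = 0)"
proof -
  have "coeff_sum_at (-1) (Q_coeffs n a) = beta_eval completions (lascoux_atom a)"
    unfolding Q_coeffs_def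
    using coeff_sum_at_expansion_eq[OF unitriangular_kaon keys_lascoux_atom_subset[OF assms(2)]
        beta_eval_completions_kaon] .
  moreover have "coeff_sum_at (-1) (M_coeffs n a) = beta_eval (\<lambda>_. 1) (quasi_lascoux n a)"
    unfolding M_coeffs_def
    using coeff_sum_at_expansion_eq[OF unitriangular_glide_poly keys_quasi_lascoux_subset
        beta_eval_one_glide_poly] .
  ultimately show ?thesis
    by (simp add: beta_eval_completions_lascoux_atom[OF assms(2)] beta_eval_one_quasi_lascoux[OF assms(2)])
qed

end
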